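(* The one-parameter subgroups $$\{(x,y)\mapsto (x+\alpha y^2,\;y):\alpha\in\mathbb{C}\}\qquad\text{and}\qquad \Big\{(x,y)\mapsto \Big(x+\beta,\;y-\beta x-\frac{\beta^2}{2}\Big):\beta\in\mathbb{C}\Big\}$$ of $\operatorname{Aut}(\mathbb{C}^2)$ generate a group $G$ that acts infinitely transitively on $\mathbb{C}^2$.
   Context: $\operatorname{Aut}(\mathbb{C}^2)$ is the group of polynomial automorphisms of the affine plane. An action of a group $G$ on a set $X$ is infinitely transitive if for every positive integer $m$ and any two $m$-tuples of pairwise distinct points of $X$ there is an element $g\in G$ sending the first tuple to the second. *)

theory Defs
  imports "HOL-Algebra.Group_Action" "HOL-Algebra.Elementary_Groups" "HOL-Computational_Algebra.Polynomial" Complex_Main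
begin

text \<open>
  A polynomial in \<open>\<complex>[x, y]\<close> is an element of \<open>\<complex>[x][y]\<close>: the outer indeterminate is \<open>y\<close>, and the
  coefficients are polynomials in \<open>x\<close>.
\<close>

definition eval2 :: "complex poly poly \<Rightarrow> complex \<times> complex \<Rightarrow> complex" where
  "eval2 p = (\<lambda>(x, y). poly (poly p [:y:]) x)"

definition polynomial_map :: "(complex \<times> complex \<Rightarrow> complex \<times> complex) \<Rightarrow> bool" where
  "polynomial_map f \<longleftrightarrow> (\<exists>p q. \<forall>z. f z = (eval2 p z, eval2 q z))"

definition Aut_C2 :: "(complex \<times> complex \<Rightarrow> complex \<times> complex) monoid" where
  "Aut_C2 =
    \<lparr>carrier = {f. polynomial_map f \<and> (\<exists>g. polynomial_map g \<and> f \<circ> g = id \<and> g \<circ> f = id)},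
     monoid.mult = (\<circ>), one = id\<rparr>"

definition additive_group_C :: "complex monoid" where
  "additive_group_C = \<lparr>carrier = UNIV, monoid.mult = (+), one = 0\<rparr>"

text \<open>
  An algebraic one-parameter subgroup: the image of an injective homomorphism \<open>\<phi>\<close> from the additive
  group for which \<open>(t, z) \<mapsto> \<phi> t z\<close> is a polynomial map \<open>\<complex> \<times> \<complex>\<^sup>2 \<rightarrow> \<complex>\<^sup>2\<close>. Here \<open>p\<close> and \<open>q\<close> are elements
  of \<open>\<complex>[x][y][t]\<close>, and substituting the constant \<open>[:[:t:]:]\<close> leaves an element of \<open>\<complex>[x][y]\<close>.
\<close>

definition one_parameter_subgroup :: "(complex \<times> complex \<Rightarrow> complex \<times> complex) set \<Rightarrow> bool" where
  "one_parameter_subgroup H \<longleftrightarrow>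
    (\<exists>\<phi> \<in> hom additive_group_C Aut_C2. inj \<phi> \<and> H = range \<phi> \<and>
      (\<exists>p q. \<forall>t z. \<phi> t z = (eval2 (poly p [:[:t:]:]) z, eval2 (poly q [:[:t:]:]) z)))"

text \<open>Tuples of pairwise distinct points are given as distinct lists.\<close>

definition infinitely_transitive ::
    "('g, 'a) monoid_scheme \<Rightarrow> 'b set \<Rightarrow> ('g \<Rightarrow> 'b \<Rightarrow> 'b) \<Rightarrow> bool" where
  "infinitely_transitive G X \<phi> \<longleftrightarrow>
    group_action G X \<phi> \<and>
    (\<forall>m > 0. \<forall>xs ys.
      length xs = m \<and> set xs \<subseteq> X \<and> distinct xs \<and>
      length ys = m \<and> set ys \<subseteq> X \<and> distinct ys \<longrightarrow>
      (\<exists>g \<in> carrier G. map (\<phi> g) xs = ys))"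

lemma eval2_comp: "\<exists>s. \<forall>z. eval2 s z = eval2 r (eval2 p z, eval2 q z)"
proof -
  have inner: "\<exists>s. \<forall>z. eval2 s z = poly a (eval2 p z)" for a
  proof (induction a)
    case 0
    show ?case by (rule exI[of _ 0]) (auto simp: eval2_def)
  next
    case (pCons c a)
    then obtain s where "\<forall>z. eval2 s z = poly a (eval2 p z)" by blast
    then show ?case by (intro exI[of _ "[:[:c:]:] + p * s"]) (auto simp: eval2_def)
  qed
  show ?thesis
  proof (induction r)
    case 0
    show ?case by (rule exI[of _ 0]) (auto simp: eval2_def)
  next
    case (pCons a r)
    from pCons.IH obtain s where s: "\<forall>z. eval2 s z = eval2 r (eval2 p z, eval2 q z)" by blast
    from inner obtain s' where "\<forall>z. eval2 s' z = poly a (eval2 p z)" by blast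
    with s show ?case by (intro exI[of _ "s' + q * s"]) (auto simp: eval2_def)
  qed
qed

lemma polynomial_map_comp:
  assumes "polynomial_map f" "polynomial_map g"
  shows "polynomial_map (f \<circ> g)"
proof -
  obtain p q p' q' where "\<forall>z. f z = (eval2 p z, eval2 q z)" "\<forall>z. g z = (eval2 p' z, eval2 q' z)"
    using assms unfolding polynomial_map_def by blast
  moreover obtain s s' where "\<forall>z. eval2 s z = eval2 p (eval2 p' z, eval2 q' z)"
    "\<forall>z. eval2 s' z = eval2 q (eval2 p' z, eval2 q' z)"
    using eval2_comp by meson
  ultimately show ?thesis unfolding polynomial_map_def
    by (intro exI[of _ s] exI[of _ s']) simp
qed

lemma polynomial_map_id: "polynomial_map id"
  unfolding polynomial_map_def
  by (intro exI[of _ "[:[:0, 1:]:]"] exI[of _ "[:0, 1:]"]) (auto simp: eval2_def)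

lemma group_Aut_C2: "group Aut_C2"
proof (rule groupI)
  fix f g assume "f \<in> carrier Aut_C2" "g \<in> carrier Aut_C2"
  then obtain f' g' where "polynomial_map f" "polynomial_map g" "polynomial_map f'" "polynomial_map g'"
    and inverses: "f \<circ> f' = id" "f' \<circ> f = id" "g \<circ> g' = id" "g' \<circ> g = id"
    by (auto simp: Aut_C2_def)
  moreover have "(f \<circ> g) \<circ> (g' \<circ> f') = id" "(g' \<circ> f') \<circ> (f \<circ> g) = id"
    using inverses by (metis comp_assoc comp_id)+
  ultimately show "f \<otimes>\<^bsub>Aut_C2\<^esub> g \<in> carrier Aut_C2"
    by (auto simp: Aut_C2_def intro!: polynomial_map_comp exI[of _ "g' \<circ> f'"])
qed (auto simp: Aut_C2_def polynomial_map_id comp_assoc)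

end

theory Submission
  imports Defs "HOL-Analysis.Analysis"
begin

text \<open>
  Both subgroups consist of time-\<open>t\<close> maps of Hamiltonian vector fields, with Hamiltonians \<open>y\<^sup>3/3\<close> and
  \<open>x\<^sup>2/2 + y\<close>. Consider the Hamiltonians \<open>f\<close> whose vector field is the velocity at \<open>s = 0\<close> of a polynomial
  family \<open>\<gamma>\<^sub>s\<close> in the group with \<open>\<gamma>\<^sub>0 = id\<close>. They form a vector space that is invariant under composition
  with group elements; as \<open>f \<circ> \<gamma>\<^sub>s\<close> is polynomial in \<open>s\<close>, its linear coefficient, a Poisson bracket, lies in
  the space as well. The Poisson algebra generated by \<open>y\<^sup>3\<close> and \<open>x\<^sup>2/2 + y\<close> contains all polynomials, so
  interpolation produces families with arbitrary velocities at finitely many given points. By the inverse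
  function theorem every orbit on tuples of distinct points is open. Two such tuples are joined by a
  complex line that meets the tuples with a repeated entry in finitely many points only, and a plane minus
  finitely many points is connected, so there is a single orbit.
\<close>

section \<open>Polynomial functions\<close>

text \<open>Only the velocity at s = 0 of a family is prescribed, because the flow of a general
  polynomial Hamiltonian is not polynomial: that of x y is exponential in time. To first order at
  the identity, composing families adds their velocities, which makes the Hamiltonians a vector
  space; and as shears and slides have Jacobian determinant 1, conjugating a family by g replaces f
  by f \<circ> g. Brackets then come without a limit process: if a polynomial in s takes values in a
  vector space of functions for every s, elimination over finitely many values of s puts its
  coefficients there too. The number 2m of coordinates of a tuple varies with m, so parameter points
  are functions on a finite index set, and the inverse function theorem is carried out there by a
  contraction argument.\<close>

text \<open>The set \<open>C\<close> of coordinate functions is a parameter, so that one notion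
  covers the plane, the plane with time added, and any number of parameters \<open>t i\<close>. Rule
  induction replaces work with coefficients.\<close>

inductive poly_fun :: "('a \<Rightarrow> complex) set \<Rightarrow> ('a \<Rightarrow> complex) \<Rightarrow> bool"
  for C :: "('a \<Rightarrow> complex) set" where
  const: "poly_fun C (\<lambda>_. c)"
| coord: "f \<in> C \<Longrightarrow> poly_fun C f"
| add: "poly_fun C f \<Longrightarrow> poly_fun C g \<Longrightarrow> poly_fun C (\<lambda>z. f z + g z)"
| mult: "poly_fun C f \<Longrightarrow> poly_fun C g \<Longrightarrow> poly_fun C (\<lambda>z. f z * g z)"

lemma poly_fun_cmult: "poly_fun C f \<Longrightarrow> poly_fun C (\<lambda>z. c * f z)"
  by (intro poly_fun.mult poly_fun.const)

lemma poly_fun_uminus: "poly_fun C f \<Longrightarrow> poly_fun C (\<lambda>z. - f z)"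
  using poly_fun_cmult[of C f "-1"] by simp

lemma poly_fun_diff: "poly_fun C f \<Longrightarrow> poly_fun C g \<Longrightarrow> poly_fun C (\<lambda>z. f z - g z)"
  using poly_fun.add[OF _ poly_fun_uminus, of C f g] by simp

lemma poly_fun_divide: "poly_fun C f \<Longrightarrow> poly_fun C (\<lambda>z. f z / c)"
  using poly_fun_cmult[of C f "inverse c"] by (simp add: field_simps)

lemma poly_fun_power: "poly_fun C f \<Longrightarrow> poly_fun C (\<lambda>z. f z ^ k)"
  by (induction k) (auto intro: poly_fun.intros)

lemma poly_fun_sum: "(\<And>i. i \<in> A \<Longrightarrow> poly_fun C (f i)) \<Longrightarrow> poly_fun C (\<lambda>z. \<Sum>i\<in>A. f i z)"
  by (induction A rule: infinite_finite_induct) (auto intro: poly_fun.intros)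

lemma poly_fun_prod: "(\<And>i. i \<in> A \<Longrightarrow> poly_fun C (f i)) \<Longrightarrow> poly_fun C (\<lambda>z. \<Prod>i\<in>A. f i z)"
  by (induction A rule: infinite_finite_induct) (auto intro: poly_fun.intros)

lemmas poly_fun_intros = poly_fun.const poly_fun.add poly_fun.mult poly_fun_uminus poly_fun_diff
  poly_fun_divide poly_fun_power

lemma poly_fun_comp:
  assumes "poly_fun C f" "\<And>c. c \<in> C \<Longrightarrow> poly_fun D (\<lambda>z. c (\<phi> z))"
  shows "poly_fun D (\<lambda>z. f (\<phi> z))"
  using assms(1) by induction (auto intro: poly_fun.intros assms(2))

lemma poly_fun_mono: "poly_fun C f \<Longrightarrow> C \<subseteq> D \<Longrightarrow> poly_fun D f"
  using poly_fun_comp[of C f D "\<lambda>z. z"] by (auto intro: poly_fun.intros)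

section \<open>Strict differentiability and local surjectivity of polynomial maps\<close>

text \<open>Pairs are used because the contraction argument compares two moving points, not one
  point with the origin. The l1 size over \<open>I\<close> ignores the values of \<open>t\<close>
  and \<open>u\<close> outside \<open>I\<close>, where they are arbitrary.\<close>

definition near_zero :: "'i set \<Rightarrow> (('i \<Rightarrow> complex) \<times> ('i \<Rightarrow> complex)) filter" where
  "near_zero I = filtercomap (\<lambda>(t, u). (\<Sum>i\<in>I. norm (t i)) + (\<Sum>i\<in>I. norm (u i))) (nhds (0::real))"

lemma eventually_near_zero:
  "eventually P (near_zero I) \<longleftrightarrow>
    (\<exists>r>0. \<forall>t u. (\<Sum>i\<in>I. norm (t i)) + (\<Sum>i\<in>I. norm (u i)) < r \<longrightarrow> P (t, u))"
proof -
  have nn: "0 \<le> (\<Sum>i\<in>I. norm (t i)) + (\<Sum>i\<in>I. norm (u i))" for t u :: "'a \<Rightarrow> complex"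
    by (intro add_nonneg_nonneg sum_nonneg) auto
  show ?thesis
    unfolding near_zero_def eventually_filtercomap eventually_nhds_metric
    by (auto simp: dist_real_def abs_of_nonneg[OF nn])
qed

lemma tendsto_coord_near_zero:
  assumes "finite I" "i \<in> I"
  shows "((\<lambda>z. fst z i) \<longlongrightarrow> 0) (near_zero I)" "((\<lambda>z. snd z i) \<longlongrightarrow> 0) (near_zero I)"
proof -
  have le: "norm (t i) \<le> (\<Sum>i\<in>I. norm (t i))" for t :: "'a \<Rightarrow> complex"
    using assms by (intro member_le_sum) auto
  have nn: "0 \<le> (\<Sum>i\<in>I. norm (t i))" for t :: "'a \<Rightarrow> complex"
    by (intro sum_nonneg) auto
  show "((\<lambda>z. fst z i) \<longlongrightarrow> 0) (near_zero I)" "((\<lambda>z. snd z i) \<longlongrightarrow> 0) (near_zero I)"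
    unfolding tendsto_iff eventually_near_zero using le nn
    by (auto simp: dist_norm intro!: exI) (smt (verit))+
qed

lemma tendsto_poly_fun_near_zero:
  assumes "finite I" "poly_fun {\<lambda>t. t i |i. i \<in> I} P"
  shows "((\<lambda>z. P (fst z)) \<longlongrightarrow> P (\<lambda>_. 0)) (near_zero I)" "((\<lambda>z. P (snd z)) \<longlongrightarrow> P (\<lambda>_. 0)) (near_zero I)"
proof -
  show "((\<lambda>z. P (fst z)) \<longlongrightarrow> P (\<lambda>_. 0)) (near_zero I)" using assms(2)
    by induction (auto intro!: tendsto_intros tendsto_coord_near_zero assms(1))
  show "((\<lambda>z. P (snd z)) \<longlongrightarrow> P (\<lambda>_. 0)) (near_zero I)" using assms(2)
    by induction (auto intro!: tendsto_intros tendsto_coord_near_zero assms(1))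
qed

text \<open>For a product, f(t) g(t) - f(u) g(u) = (f(t) - f(u)) g(t) + f(u) (g(t) - g(u)) combines
  the factors \<open>D\<close> and \<open>E\<close> of f and g into one for f g. The limits
  \<open>a\<close> turn out to be the partial derivatives at the origin.\<close>

lemma poly_fun_hadamard:
  assumes I: "finite I" and "poly_fun {\<lambda>t. t i |i. i \<in> I} P"
  obtains D a where "\<And>i. i \<in> I \<Longrightarrow> (D i \<longlongrightarrow> a i) (near_zero I)"
    "\<And>t u. P t - P u = (\<Sum>i\<in>I. D i (t, u) * (t i - u i))"
    "\<And>i. a i = D i (\<lambda>_. 0, \<lambda>_. 0)"
proof -
  have "\<exists>D a. (\<forall>i\<in>I. (D i \<longlongrightarrow> a i) (near_zero I)) \<and>
    (\<forall>t u. P t - P u = (\<Sum>i\<in>I. D i (t, u) * (t i - u i))) \<and> (\<forall>i. a i = D i (\<lambda>_. 0, \<lambda>_. 0))"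
    using assms(2)
  proof induction
    case (const c)
    show ?case by (intro exI[of _ "\<lambda>_ _. 0"] exI[of _ "\<lambda>_. 0"]) auto
  next
    case (coord f)
    then obtain j where j: "j \<in> I" "f = (\<lambda>t. t j)" by auto
    show ?case
      using j I by (intro exI[of _ "\<lambda>i _. if i = j then 1 else 0"] exI[of _ "\<lambda>i. if i = j then 1 else 0"])
        (auto simp: if_distrib if_distribR sum.delta cong: if_cong)
  next
    case (add f g)
    from add.IH(1) obtain D a where
      D: "\<forall>i\<in>I. (D i \<longlongrightarrow> a i) (near_zero I)" "\<forall>t u. f t - f u = (\<Sum>i\<in>I. D i (t, u) * (t i - u i))"
      "\<forall>i. a i = D i (\<lambda>_. 0, \<lambda>_. 0)" by blast
    from add.IH(2) obtain E b where
      E: "\<forall>i\<in>I. (E i \<longlongrightarrow> b i) (near_zero I)" "\<forall>t u. g t - g u = (\<Sum>i\<in>I. E i (t, u) * (t i - u i))"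
      "\<forall>i. b i = E i (\<lambda>_. 0, \<lambda>_. 0)" by blast
    have "f t + g t - (f u + g u) = (\<Sum>i\<in>I. (D i (t, u) + E i (t, u)) * (t i - u i))" for t u
    proof -
      have "f t + g t - (f u + g u) = (f t - f u) + (g t - g u)" by simp
      also have "\<dots> = (\<Sum>i\<in>I. (D i (t, u) + E i (t, u)) * (t i - u i))"
        unfolding D(2)[rule_format] E(2)[rule_format] by (simp add: distrib_right sum.distrib)
      finally show ?thesis .
    qed
    then show ?case using D E
      by (intro exI[of _ "\<lambda>i z. D i z + E i z"] exI[of _ "\<lambda>i. a i + b i"]) (auto intro!: tendsto_intros)
  next
    case (mult f g)
    from mult.IH(1) obtain D a where
      D: "\<forall>i\<in>I. (D i \<longlongrightarrow> a i) (near_zero I)" "\<forall>t u. f t - f u = (\<Sum>i\<in>I. D i (t, u) * (t i - u i))"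
      "\<forall>i. a i = D i (\<lambda>_. 0, \<lambda>_. 0)" by blast
    from mult.IH(2) obtain E b where
      E: "\<forall>i\<in>I. (E i \<longlongrightarrow> b i) (near_zero I)" "\<forall>t u. g t - g u = (\<Sum>i\<in>I. E i (t, u) * (t i - u i))"
      "\<forall>i. b i = E i (\<lambda>_. 0, \<lambda>_. 0)" by blast
    have "f t * g t - f u * g u = (\<Sum>i\<in>I. (D i (t, u) * g t + f u * E i (t, u)) * (t i - u i))" for t u
    proof -
      have "f t * g t - f u * g u = (f t - f u) * g t + f u * (g t - g u)" by (simp add: algebra_simps)
      also have "\<dots> = (\<Sum>i\<in>I. (D i (t, u) * g t + f u * E i (t, u)) * (t i - u i))"
        unfolding D(2)[rule_format] E(2)[rule_format] sum_distrib_left sum_distrib_right sum.distrib[symmetric]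
        by (intro sum.cong refl) (simp add: algebra_simps)
      finally show ?thesis .
    qed
    then show ?case using D E
      by (intro exI[of _ "\<lambda>i z. D i z * g (fst z) + f (snd z) * E i z"]
          exI[of _ "\<lambda>i. a i * g (\<lambda>_. 0) + f (\<lambda>_. 0) * b i"])
        (auto intro!: tendsto_intros tendsto_poly_fun_near_zero I mult.hyps)
  qed
  then show ?thesis using that by blast
qed

text \<open>Once every \<open>D i\<close> is within \<open>c\<close> of its limit, the factorisation
  of P(t) - P(u) gives the bound. Derivatives along the axes thus control differences of any two
  points near the origin, as a contraction estimate demands.\<close>

lemma poly_fun_strict_diff:
  assumes I: "finite I" and P: "poly_fun {\<lambda>t. t i |i. i \<in> I} P" and "0 < c"
    and deriv: "\<And>j. j \<in> I \<Longrightarrow>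
      ((\<lambda>s. P (\<lambda>i. if i = j then s else 0)) has_field_derivative d j) (at 0)"
  shows "\<forall>\<^sub>F (t, u) in near_zero I.
    norm (P t - P u - (\<Sum>i\<in>I. d i * (t i - u i))) \<le> c * (\<Sum>i\<in>I. norm (t i - u i))"
proof -
  obtain D a where D: "\<And>i. i \<in> I \<Longrightarrow> (D i \<longlongrightarrow> a i) (near_zero I)"
    "\<And>t u. P t - P u = (\<Sum>i\<in>I. D i (t, u) * (t i - u i))" "\<And>i. a i = D i (\<lambda>_. 0, \<lambda>_. 0)"
    by (rule poly_fun_hadamard[OF I P]) blast
  have ad: "a j = d j" if j: "j \<in> I" for j
  proof -
    \<comment> \<open>\<open>e s\<close> is the point \<open>s\<close> on the j-th axis. With
      \<open>u = 0\<close> only the j-th term of the factorisation survives there, so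
      \<open>D j\<close> is the difference quotient and its limit is \<open>d j\<close>.\<close>
    define e where "e s = (\<lambda>i. if i = j then s else (0::complex))" for s
    have lim: "filterlim (\<lambda>s. (e s, \<lambda>_. 0)) (near_zero I) (nhds 0)"
      unfolding near_zero_def filterlim_filtercomap_iff
    proof -
      have "((\<lambda>s::complex. norm s) \<longlongrightarrow> 0) (nhds 0)"
        by (rule tendsto_norm_zero[OF filterlim_ident])
      moreover have "(\<Sum>i\<in>I. norm (e s i)) = norm s" for s
        using j I by (simp add: e_def if_distrib cong: if_cong)
      ultimately show "filterlim ((\<lambda>(t, u). (\<Sum>i\<in>I. norm (t i)) + (\<Sum>i\<in>I. norm (u i))) \<circ> (\<lambda>s. (e s, \<lambda>_. 0))) (nhds 0) (nhds 0)"
        by (simp add: o_def)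
    qed
    have "((\<lambda>s. D j (e s, \<lambda>_. 0)) \<longlongrightarrow> a j) (at 0)"
      using filterlim_compose[OF D(1)[OF j] lim] by (rule filterlim_mono) (auto simp: at_within_def)
    moreover have "P (e s) - P (e 0) = D j (e s, \<lambda>_. 0) * s" for s
    proof -
      have "e 0 = (\<lambda>_. 0)" by (auto simp: e_def)
      then have "P (e s) - P (e 0) = (\<Sum>i\<in>I. D i (e s, \<lambda>_. 0) * e s i)" by (simp add: D(2))
      also have "\<dots> = D j (e s, \<lambda>_. 0) * s"
        using I j by (simp add: e_def if_distrib[of "\<lambda>x. _ * x"] cong: if_cong)
      finally show ?thesis .
    qed
    ultimately have "((\<lambda>s. (P (e s) - P (e 0)) / s) \<longlongrightarrow> a j) (at 0)"
      by (rule_tac Lim_transform_eventually) (auto simp: eventually_at_filter)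
    then have "((\<lambda>s. P (e s)) has_field_derivative a j) (at 0)"
      by (simp add: has_field_derivative_iff)
    then show ?thesis using deriv[OF j] DERIV_unique unfolding e_def by blast
  qed
  have "\<forall>\<^sub>F z in near_zero I. \<forall>i\<in>I. dist (D i z) (d i) < c"
    using I D(1) ad \<open>0 < c\<close> by (intro eventually_ball_finite) (auto simp: tendsto_iff)
  then show ?thesis
  proof (rule eventually_mono, clarify)
    fix t u assume near: "\<forall>i\<in>I. dist (D i (t, u)) (d i) < c"
    have "P t - P u - (\<Sum>i\<in>I. d i * (t i - u i)) = (\<Sum>i\<in>I. (D i (t, u) - d i) * (t i - u i))"
      by (simp add: D(2) left_diff_distrib sum_subtractf)
    also have "norm \<dots> \<le> (\<Sum>i\<in>I. c * norm (t i - u i))"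
      using near by (intro sum_norm_le) (simp add: norm_mult dist_norm mult_right_mono less_imp_le)
    finally show "norm (P t - P u - (\<Sum>i\<in>I. d i * (t i - u i))) \<le> c * (\<Sum>i\<in>I. norm (t i - u i))"
      by (simp add: sum_distrib_left)
  qed
qed

text \<open>The surjective half of the inverse function theorem at a point with identity derivative:
  F(t) = y is solved by iterating t - F(t) + y from 0.\<close>

lemma poly_map_locally_onto:
  assumes I: "finite I" and F: "\<And>k. k \<in> I \<Longrightarrow> poly_fun {\<lambda>t. t i |i. i \<in> I} (F k)"
    and F0: "\<And>k. k \<in> I \<Longrightarrow> F k (\<lambda>_. 0) = 0"
    and deriv: "\<And>j k. j \<in> I \<Longrightarrow> k \<in> I \<Longrightarrow>
      ((\<lambda>s. F k (\<lambda>i. if i = j then s else 0)) has_field_derivative (if j = k then 1 else 0)) (at 0)"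
  obtains \<epsilon> :: real where "0 < \<epsilon>"
    "\<And>y. (\<And>k. k \<in> I \<Longrightarrow> norm (y k) < \<epsilon>) \<Longrightarrow> \<exists>t. \<forall>k\<in>I. F k t = y k"
proof -
  define N where "N t = (\<Sum>i\<in>I. norm (t i))" for t :: "'a \<Rightarrow> complex"
  \<comment> \<open>The error in each coordinate is at most \<open>c\<close> times the size of the
    difference; summed over \<open>I\<close> it is at most half of that size. The summand 1 keeps
    \<open>c\<close> positive when \<open>I\<close> is empty.\<close>
  define c where "c = 1 / (2 * (real (card I) + 1))"
  have c: "0 < c" "real (card I) * c \<le> 1 / 2" by (auto simp: c_def field_simps)
  have N0: "0 \<le> N t" for t unfolding N_def by (intro sum_nonneg) auto
  have Ncoord: "norm (t k) \<le> N t" if "k \<in> I" for t k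
    unfolding N_def using that I by (intro member_le_sum) auto
  have Ntri: "N (\<lambda>i. t i + u i) \<le> N t + N u" for t u
    unfolding N_def sum.distrib[symmetric] by (intro sum_mono norm_triangle_ineq)
  have "\<forall>\<^sub>F (t, u) in near_zero I. \<forall>k\<in>I. norm (F k t - F k u - (t k - u k)) \<le> c * N (\<lambda>i. t i - u i)"
  proof -
    have "\<forall>\<^sub>F z in near_zero I. \<forall>k\<in>I.
      norm (F k (fst z) - F k (snd z) - (fst z k - snd z k)) \<le> c * N (\<lambda>i. fst z i - snd z i)"
    proof (intro eventually_ball_finite I ballI)
      fix k assume k: "k \<in> I"
      have "(\<Sum>i\<in>I. (if i = k then 1 else 0) * (t i - u i)) = t k - u k" for t u :: "'a \<Rightarrow> complex"
        using I k by (simp add: if_distribR if_distrib cong: if_cong)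
      with poly_fun_strict_diff[OF I F[OF k] c(1), of "\<lambda>i. if i = k then 1 else 0"] deriv[OF _ k]
      show "\<forall>\<^sub>F z in near_zero I.
        norm (F k (fst z) - F k (snd z) - (fst z k - snd z k)) \<le> c * N (\<lambda>i. fst z i - snd z i)"
        by (simp add: N_def case_prod_unfold)
    qed
    then show ?thesis by (simp add: case_prod_unfold)
  qed
  then obtain r where r: "0 < r" "\<And>t u k. N t + N u < r \<Longrightarrow> k \<in> I \<Longrightarrow>
      norm (F k t - F k u - (t k - u k)) \<le> c * N (\<lambda>i. t i - u i)"
    unfolding eventually_near_zero N_def by fast
  \<comment> \<open>This makes \<open>N y \<le> r / 8\<close>. The iterates stay within
    \<open>2 * N y\<close>, so two of them have total size below \<open>r\<close>.\<close>
  define \<epsilon> where "\<epsilon> = r / (8 * (real (card I) + 1))"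
  have "\<exists>t. \<forall>k\<in>I. F k t = y k" if y: "\<And>k. k \<in> I \<Longrightarrow> norm (y k) < \<epsilon>" for y
  proof -
    define T where "T t = (\<lambda>k. t k - F k t + y k)" for t
    define a where "a n = (T ^^ n) (\<lambda>_. 0)" for n
    have contr: "N (\<lambda>i. T t i - T u i) \<le> N (\<lambda>i. t i - u i) / 2" if "N t + N u < r" for t u
    proof -
      have "N (\<lambda>i. T t i - T u i) \<le> (\<Sum>i\<in>I. c * N (\<lambda>i. t i - u i))"
        unfolding N_def[of "\<lambda>i. T t i - T u i"]
      proof (rule sum_mono)
        fix k assume k: "k \<in> I"
        have "norm (T t k - T u k) = norm (F k t - F k u - (t k - u k))"
          unfolding T_def by (subst norm_minus_cancel[symmetric]) (simp add: algebra_simps)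
        then show "norm (T t k - T u k) \<le> c * N (\<lambda>i. t i - u i)" using r(2)[OF that k] by simp
      qed
      also have "\<dots> = (real (card I) * c) * N (\<lambda>i. t i - u i)" by simp
      also have "\<dots> \<le> 1 / 2 * N (\<lambda>i. t i - u i)" using c N0 by (intro mult_right_mono) auto
      finally show ?thesis by simp
    qed
    have Ny: "N y \<le> r / 8"
    proof -
      have "N y \<le> (\<Sum>i\<in>I. \<epsilon>)" unfolding N_def using y by (intro sum_mono) (auto intro: less_imp_le)
      also have "\<dots> \<le> r / 8" using \<open>0 < r\<close> by (simp add: \<epsilon>_def field_simps)
      finally show ?thesis .
    qed
    have a0: "a 0 = (\<lambda>_. 0)" and aS: "a (Suc n) = T (a n)" for n by (auto simp: a_def)
    \<comment> \<open>The increments halve, so partial geometric sums bound the iterates. The last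
      conjunct bounds the second of the two points to which \<open>contr\<close> is applied.\<close>
    have inv: "N (\<lambda>i. a (Suc n) i - a n i) \<le> N y / 2 ^ n \<and> N (a (Suc n)) \<le> 2 * N y * (1 - 1 / 2 ^ Suc n) \<and> N (a n) \<le> 2 * N y" for n
    proof (induction n)
      case 0
      have "N (T (\<lambda>_. 0)) = N y" unfolding N_def using F0 by (intro sum.cong) (auto simp: T_def)
      moreover have "N (\<lambda>_. 0) = 0" by (simp add: N_def)
      ultimately show ?case using N0[of y] by (simp add: a0 aS)
    next
      case (Suc n)
      have le: "N (a (Suc n)) \<le> 2 * N y"
        using Suc.IH N0[of y] mult_left_mono[of "1 - 1 / 2 ^ Suc n" 1 "2 * N y"] by auto
      have lt: "N (a (Suc n)) + N (a n) < r" using le Suc.IH Ny \<open>0 < r\<close> by linarith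
      have d: "N (\<lambda>i. a (Suc (Suc n)) i - a (Suc n) i) \<le> N y / 2 ^ Suc n"
        using contr[OF lt] Suc.IH by (simp add: aS)
      have "N (a (Suc (Suc n))) \<le> N (a (Suc n)) + N (\<lambda>i. a (Suc (Suc n)) i - a (Suc n) i)"
        using Ntri[of "a (Suc n)" "\<lambda>i. a (Suc (Suc n)) i - a (Suc n) i"] by simp
      also have "\<dots> \<le> 2 * N y * (1 - 1 / 2 ^ Suc n) + N y / 2 ^ Suc n" using Suc.IH d by linarith
      also have "\<dots> = 2 * N y * (1 - 1 / 2 ^ Suc (Suc n))" by (simp add: field_simps)
      finally show ?case using d le by blast
    qed
    have "\<exists>l. (\<lambda>n. a n k) \<longlonglongrightarrow> l" if k: "k \<in> I" for k
    proof -
      have "summable (\<lambda>n. a (Suc n) k - a n k)"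
      proof (rule summable_comparison_test'[OF summable_mult[OF summable_geometric]])
        show "norm (1 / 2 :: real) < 1" by simp
        fix n :: nat
        have "norm (a (Suc n) k - a n k) \<le> N y / 2 ^ n"
          using Ncoord[OF k, of "\<lambda>i. a (Suc n) i - a n i"] inv[of n] by linarith
        then show "norm (a (Suc n) k - a n k) \<le> N y * (1 / 2) ^ n" by (simp add: power_one_over)
      qed
      then show ?thesis
        by (simp add: summable_iff_convergent sum_lessThan_telescope[of "\<lambda>n. a n k"] a0 convergent_def)
    qed
    then have "\<forall>k\<in>I. \<exists>l. (\<lambda>n. a n k) \<longlonglongrightarrow> l" by blast
    then obtain b where b: "\<And>k. k \<in> I \<Longrightarrow> (\<lambda>n. a n k) \<longlonglongrightarrow> b k" unfolding bchoice_iff by blast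
    have Nlim: "(\<lambda>n. N (\<lambda>i. a n i - b i)) \<longlonglongrightarrow> 0"
      unfolding N_def using b
      by (intro tendsto_null_sum tendsto_norm_zero) (simp add: LIM_zero)
    have Nb: "N b \<le> 2 * N y"
    proof (rule LIMSEQ_le_const2)
      show "(\<lambda>n. N (a n)) \<longlonglongrightarrow> N b" unfolding N_def using b by (intro tendsto_intros)
    qed (use inv in blast)
    \<comment> \<open>\<open>T b - b\<close> is the sum of \<open>T b - T (a n)\<close> and
      \<open>a (Suc n) - b\<close>, and both tend to 0 on \<open>I\<close>.\<close>
    have "N (\<lambda>i. T b i - b i) \<le> 0"
    proof (rule LIMSEQ_le_const)
      show "(\<lambda>n. N (\<lambda>i. a n i - b i) / 2 + N (\<lambda>i. a (Suc n) i - b i)) \<longlonglongrightarrow> 0"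
        using tendsto_add[OF tendsto_divide[OF Nlim tendsto_const[of 2]] LIMSEQ_Suc[OF Nlim]] by simp
      have "N (\<lambda>i. T b i - b i) \<le> N (\<lambda>i. a n i - b i) / 2 + N (\<lambda>i. a (Suc n) i - b i)" for n
      proof -
        have "N b + N (a n) < r" using Nb inv[of n] Ny \<open>0 < r\<close> by linarith
        then have "N (\<lambda>i. T b i - T (a n) i) \<le> N (\<lambda>i. b i - a n i) / 2" by (rule contr)
        moreover have "N (\<lambda>i. b i - a n i) = N (\<lambda>i. a n i - b i)" by (simp add: N_def norm_minus_commute)
        ultimately show ?thesis
          using Ntri[of "\<lambda>i. T b i - T (a n) i" "\<lambda>i. a (Suc n) i - b i"] by (simp add: aS)
      qed
      then show "\<exists>M. \<forall>n\<ge>M. N (\<lambda>i. T b i - b i) \<le> N (\<lambda>i. a n i - b i) / 2 + N (\<lambda>i. a (Suc n) i - b i)"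
        by blast
    qed
    then have "norm (T b k - b k) \<le> 0" if "k \<in> I" for k
      using Ncoord[OF that, of "\<lambda>i. T b i - b i"] by linarith
    then show ?thesis by (intro exI[of _ b]) (simp add: T_def)
  qed
  moreover have "0 < \<epsilon>" using \<open>0 < r\<close> by (simp add: \<epsilon>_def)
  ultimately show ?thesis using that by blast
qed

section \<open>Derivatives along curves and gradients on the plane\<close>

text \<open>The coefficients \<open>a\<close> are chosen before the curve: they are the partial
  derivatives of \<open>f\<close> at \<open>z\<close>, and test curves can later identify
  them.\<close>

lemma poly_fun_curve_derivative:
  assumes "finite C" "poly_fun C f"
  obtains a where "\<And>w w'. w 0 = z \<Longrightarrow> (\<And>c. c \<in> C \<Longrightarrow> ((\<lambda>s. c (w s)) has_field_derivative w' c) (at 0)) \<Longrightarrow>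
    ((\<lambda>s. f (w s)) has_field_derivative (\<Sum>c\<in>C. a c * w' c)) (at 0)"
proof -
  have "\<exists>a. \<forall>w w'. w 0 = z \<longrightarrow> (\<forall>c\<in>C. ((\<lambda>s. c (w s)) has_field_derivative w' c) (at 0)) \<longrightarrow>
    ((\<lambda>s. f (w s)) has_field_derivative (\<Sum>c\<in>C. a c * w' c)) (at 0)"
    using assms(2)
  proof induction
    case (const k)
    show ?case by (rule exI[of _ "\<lambda>_. 0"]) simp
  next
    case (coord f)
    show ?case
    proof (intro exI[of _ "\<lambda>c. if c = f then 1 else 0"] allI impI)
      fix w w' assume "\<forall>c\<in>C. ((\<lambda>s. c (w s)) has_field_derivative w' c) (at 0)"
      moreover have "(\<Sum>c\<in>C. (if c = f then 1 else 0) * w' c) = w' f"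
        using coord assms(1) by (simp add: if_distribR if_distrib cong: if_cong)
      ultimately show "((\<lambda>s. f (w s)) has_field_derivative (\<Sum>c\<in>C. (if c = f then 1 else 0) * w' c)) (at 0)"
        using coord by simp
    qed
  next
    case (add f g)
    from add.IH(1) obtain a where
      a: "\<And>w w'. w 0 = z \<Longrightarrow> \<forall>c\<in>C. ((\<lambda>s. c (w s)) has_field_derivative w' c) (at 0) \<Longrightarrow>
        ((\<lambda>s. f (w s)) has_field_derivative (\<Sum>c\<in>C. a c * w' c)) (at 0)" by blast
    from add.IH(2) obtain b where
      b: "\<And>w w'. w 0 = z \<Longrightarrow> \<forall>c\<in>C. ((\<lambda>s. c (w s)) has_field_derivative w' c) (at 0) \<Longrightarrow>
        ((\<lambda>s. g (w s)) has_field_derivative (\<Sum>c\<in>C. b c * w' c)) (at 0)" by blast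
    have "(\<Sum>c\<in>C. (a c + b c) * w' c) = (\<Sum>c\<in>C. a c * w' c) + (\<Sum>c\<in>C. b c * w' c)" for w'
      by (simp add: distrib_right sum.distrib)
    then show ?case
      by (intro exI[of _ "\<lambda>c. a c + b c"] allI impI) (simp add: DERIV_add a b)
  next
    case (mult f g)
    from mult.IH(1) obtain a where
      a: "\<And>w w'. w 0 = z \<Longrightarrow> \<forall>c\<in>C. ((\<lambda>s. c (w s)) has_field_derivative w' c) (at 0) \<Longrightarrow>
        ((\<lambda>s. f (w s)) has_field_derivative (\<Sum>c\<in>C. a c * w' c)) (at 0)" by blast
    from mult.IH(2) obtain b where
      b: "\<And>w w'. w 0 = z \<Longrightarrow> \<forall>c\<in>C. ((\<lambda>s. c (w s)) has_field_derivative w' c) (at 0) \<Longrightarrow>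
        ((\<lambda>s. g (w s)) has_field_derivative (\<Sum>c\<in>C. b c * w' c)) (at 0)" by blast
    show ?case
    proof (intro exI[of _ "\<lambda>c. a c * g z + b c * f z"] allI impI)
      fix w w' assume w: "w 0 = z" "\<forall>c\<in>C. ((\<lambda>s. c (w s)) has_field_derivative w' c) (at 0)"
      have "(\<Sum>c\<in>C. (a c * g z + b c * f z) * w' c) =
          (\<Sum>c\<in>C. a c * w' c) * g (w 0) + (\<Sum>c\<in>C. b c * w' c) * f (w 0)"
        unfolding w(1) sum_distrib_right sum.distrib[symmetric]
        by (intro sum.cong refl) (simp add: algebra_simps)
      then show "((\<lambda>s. f (w s) * g (w s)) has_field_derivative
          (\<Sum>c\<in>C. (a c * g z + b c * f z) * w' c)) (at 0)"
        using DERIV_mult[OF a[OF w] b[OF w]] by simp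
    qed
  qed
  then show ?thesis using that by blast
qed

abbreviation plane_coords :: "(complex \<times> complex \<Rightarrow> complex) set" where
  "plane_coords \<equiv> {fst, snd}"

abbreviation space_coords :: "(complex \<times> complex \<times> complex \<Rightarrow> complex) set" where
  "space_coords \<equiv> {fst, \<lambda>p. fst (snd p), \<lambda>p. snd (snd p)}"

text \<open>A sum over \<open>plane_coords\<close> has one term per element of a set of functions,
  so splitting it requires the coordinates to differ as functions.\<close>

lemma plane_coords_distinct: "(fst :: complex \<times> complex \<Rightarrow> complex) \<noteq> snd"
  by (auto dest: fun_cong[of _ _ "(0, 1)"])

lemma space_coords_distinct:
  "(fst :: complex \<times> complex \<times> complex \<Rightarrow> complex) \<noteq> (\<lambda>p. fst (snd p))"
  "(fst :: complex \<times> complex \<times> complex \<Rightarrow> complex) \<noteq> (\<lambda>p. snd (snd p))"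
  "(\<lambda>p :: complex \<times> complex \<times> complex. fst (snd p)) \<noteq> (\<lambda>p. snd (snd p))"
  by (auto dest: fun_cong[of _ _ "(0, 1, 1)"] fun_cong[of _ _ "(0, 0, 1)"])

text \<open>The chain rule along arbitrary complex curves is taken as the definition: it is the form
  in which gradients are applied to the curves traced by a family, and it yields complex rather than
  real derivatives.\<close>

definition has_gradient ::
    "(complex \<times> complex \<Rightarrow> complex) \<Rightarrow> (complex \<times> complex \<Rightarrow> complex) \<Rightarrow> (complex \<times> complex \<Rightarrow> complex) \<Rightarrow> bool" where
  "has_gradient f fx fy \<longleftrightarrow> (\<forall>w a b.
    ((\<lambda>s. fst (w s)) has_field_derivative a) (at 0) \<longrightarrow>
    ((\<lambda>s. snd (w s)) has_field_derivative b) (at 0) \<longrightarrow>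
    ((\<lambda>s. f (w s)) has_field_derivative fx (w 0) * a + fy (w 0) * b) (at 0))"

lemma has_gradientD:
  "has_gradient f fx fy \<Longrightarrow> ((\<lambda>s. fst (w s)) has_field_derivative a) (at 0) \<Longrightarrow>
    ((\<lambda>s. snd (w s)) has_field_derivative b) (at 0) \<Longrightarrow>
    ((\<lambda>s. f (w s)) has_field_derivative fx (w 0) * a + fy (w 0) * b) (at 0)"
  unfolding has_gradient_def by blast

text \<open>The two coordinate lines through \<open>z\<close> serve as test curves and separate the
  partial derivatives.\<close>

lemma has_gradient_unique:
  assumes "has_gradient f fx fy" "has_gradient f gx gy"
  shows "fx = gx" "fy = gy"
proof -
  have "fx z = gx z \<and> fy z = gy z" for z
  proof
    have x: "((\<lambda>s. fst (fst z + s, snd z)) has_field_derivative 1) (at 0)"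
      "((\<lambda>s. snd (fst z + s, snd z)) has_field_derivative 0) (at 0)"
      by (auto intro!: derivative_eq_intros)
    show "fx z = gx z"
      using DERIV_unique[OF has_gradientD[OF assms(1) x] has_gradientD[OF assms(2) x]] by simp
    have y: "((\<lambda>s. fst (fst z, snd z + s)) has_field_derivative 0) (at 0)"
      "((\<lambda>s. snd (fst z, snd z + s)) has_field_derivative 1) (at 0)"
      by (auto intro!: derivative_eq_intros)
    show "fy z = gy z"
      using DERIV_unique[OF has_gradientD[OF assms(1) y] has_gradientD[OF assms(2) y]] by simp
  qed
  then show "fx = gx" "fy = gy" by auto
qed

lemma poly_fun_has_gradient:
  assumes "poly_fun plane_coords f"
  obtains fx fy where "has_gradient f fx fy"
proof -
  have "\<exists>p q. \<forall>w a b. w 0 = z \<longrightarrow> ((\<lambda>s. fst (w s)) has_field_derivative a) (at 0) \<longrightarrow>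
      ((\<lambda>s. snd (w s)) has_field_derivative b) (at 0) \<longrightarrow>
      ((\<lambda>s. f (w s)) has_field_derivative p * a + q * b) (at 0)" for z
  proof -
    obtain c where c: "\<And>w w'. w 0 = z \<Longrightarrow>
        (\<And>k. k \<in> plane_coords \<Longrightarrow> ((\<lambda>s. k (w s)) has_field_derivative w' k) (at 0)) \<Longrightarrow>
        ((\<lambda>s. f (w s)) has_field_derivative (\<Sum>k\<in>plane_coords. c k * w' k)) (at 0)"
      by (rule poly_fun_curve_derivative[OF _ assms, of z]) auto
    show ?thesis
    proof (rule exI[of _ "c fst"], rule exI[of _ "c snd"], intro allI impI)
      fix w :: "complex \<Rightarrow> complex \<times> complex" and a b
      assume w: "w 0 = z" "((\<lambda>s. fst (w s)) has_field_derivative a) (at 0)"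
        "((\<lambda>s. snd (w s)) has_field_derivative b) (at 0)"
      have "((\<lambda>s. k (w s)) has_field_derivative (if k = fst then a else b)) (at 0)" if "k \<in> plane_coords" for k
        using that w plane_coords_distinct by auto
      from c[where w = w and w' = "\<lambda>k. if k = fst then a else b", OF w(1) this] show "((\<lambda>s. f (w s)) has_field_derivative c fst * a + c snd * b) (at 0)"
        using plane_coords_distinct by auto
    qed
  qed
  then obtain fx fy where "\<And>z w a b. w 0 = z \<Longrightarrow> ((\<lambda>s. fst (w s)) has_field_derivative a) (at 0) \<Longrightarrow>
      ((\<lambda>s. snd (w s)) has_field_derivative b) (at 0) \<Longrightarrow>
      ((\<lambda>s. f (w s)) has_field_derivative fx z * a + fy z * b) (at 0)" by metis
  then have "has_gradient f fx fy" unfolding has_gradient_def by blast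
  then show ?thesis by (rule that)
qed

lemma has_gradient_const: "has_gradient (\<lambda>_. c) (\<lambda>_. 0) (\<lambda>_. 0)"
  unfolding has_gradient_def by simp

lemma has_gradient_fst: "has_gradient fst (\<lambda>_. 1) (\<lambda>_. 0)"
  unfolding has_gradient_def by simp

lemma has_gradient_snd: "has_gradient snd (\<lambda>_. 0) (\<lambda>_. 1)"
  unfolding has_gradient_def by simp

lemma has_gradient_add:
  assumes "has_gradient f fx fy" "has_gradient g gx gy"
  shows "has_gradient (\<lambda>z. f z + g z) (\<lambda>z. fx z + gx z) (\<lambda>z. fy z + gy z)"
  unfolding has_gradient_def
  by (auto intro!: derivative_eq_intros has_gradientD[OF assms(1)] has_gradientD[OF assms(2)] simp: algebra_simps)

lemma has_gradient_mult:
  assumes "has_gradient f fx fy" "has_gradient g gx gy"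
  shows "has_gradient (\<lambda>z. f z * g z) (\<lambda>z. fx z * g z + f z * gx z) (\<lambda>z. fy z * g z + f z * gy z)"
  unfolding has_gradient_def
  by (auto intro!: derivative_eq_intros has_gradientD[OF assms(1)] has_gradientD[OF assms(2)] simp: algebra_simps)

lemma has_gradient_cmult:
  "has_gradient f fx fy \<Longrightarrow> has_gradient (\<lambda>z. c * f z) (\<lambda>z. c * fx z) (\<lambda>z. c * fy z)"
  using has_gradient_mult[OF has_gradient_const[of c]] by fastforce

lemma has_gradient_power:
  assumes "has_gradient f fx fy"
  shows "has_gradient (\<lambda>z. f z ^ k) (\<lambda>z. of_nat k * f z ^ (k - 1) * fx z) (\<lambda>z. of_nat k * f z ^ (k - 1) * fy z)"
  unfolding has_gradient_def
  by (auto intro!: derivative_eq_intros has_gradientD[OF assms] simp: algebra_simps)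

section \<open>Hamiltonians tangent to the group\<close>

definition shear :: "complex \<Rightarrow> complex \<times> complex \<Rightarrow> complex \<times> complex" where
  "shear \<alpha> = (\<lambda>(x, y). (x + \<alpha> * y^2, y))"

definition slide :: "complex \<Rightarrow> complex \<times> complex \<Rightarrow> complex \<times> complex" where
  "slide \<beta> = (\<lambda>(x, y). (x + \<beta>, y - \<beta> * x - \<beta>^2 / 2))"

lemma shear_add: "shear a \<circ> shear b = shear (a + b)"
  by (auto simp: shear_def algebra_simps)

lemma slide_add: "slide a \<circ> slide b = slide (a + b)"
  by (auto simp: slide_def field_simps power2_eq_square)

lemma shear_0: "shear 0 = id"
  by (auto simp: shear_def)

lemma slide_0: "slide 0 = id"
  by (auto simp: slide_def)

text \<open>The inverse of a generator is the generator with negated parameter, so left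
  multiplication by generators already gives a group and inductions have no case for
  inverses.\<close>

inductive_set shear_slide_words :: "(complex \<times> complex \<Rightarrow> complex \<times> complex) set" where
  id: "id \<in> shear_slide_words"
| shear: "g \<in> shear_slide_words \<Longrightarrow> shear \<alpha> \<circ> g \<in> shear_slide_words"
| slide: "g \<in> shear_slide_words \<Longrightarrow> slide \<beta> \<circ> g \<in> shear_slide_words"

lemma shear_in_words: "shear \<alpha> \<in> shear_slide_words"
  using shear_slide_words.shear[OF shear_slide_words.id] by simp

lemma slide_in_words: "slide \<beta> \<in> shear_slide_words"
  using shear_slide_words.slide[OF shear_slide_words.id] by simp

lemma words_comp: "g \<in> shear_slide_words \<Longrightarrow> h \<in> shear_slide_words \<Longrightarrow> g \<circ> h \<in> shear_slide_words"
  by (induction rule: shear_slide_words.induct) (auto simp: comp_assoc intro: shear_slide_words.intros)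

text \<open>Reverse the word and negate its parameters.\<close>

lemma words_left_inverse: "g \<in> shear_slide_words \<Longrightarrow> \<exists>h\<in>shear_slide_words. h \<circ> g = id"
proof (induction rule: shear_slide_words.induct)
  case id
  show ?case by (intro bexI[of _ id] shear_slide_words.id) simp
next
  case (shear g \<alpha>)
  then obtain h where h: "h \<in> shear_slide_words" "h \<circ> g = id" by blast
  have "(h \<circ> shear (- \<alpha>)) \<circ> (shear \<alpha> \<circ> g) = h \<circ> (shear (- \<alpha>) \<circ> shear \<alpha>) \<circ> g"
    by (simp add: comp_assoc)
  also have "\<dots> = id" by (simp add: shear_add shear_0 h)
  finally show ?case using words_comp[OF h(1) shear_in_words] by blast
next
  case (slide g \<beta>)
  then obtain h where h: "h \<in> shear_slide_words" "h \<circ> g = id" by blast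
  have "(h \<circ> slide (- \<beta>)) \<circ> (slide \<beta> \<circ> g) = h \<circ> (slide (- \<beta>) \<circ> slide \<beta>) \<circ> g"
    by (simp add: comp_assoc)
  also have "\<dots> = id" by (simp add: slide_add slide_0 h)
  finally show ?case using words_comp[OF h(1) slide_in_words] by blast
qed

section \<open>Polynomial families in the group and their velocities\<close>

text \<open>Families need not be one-parameter groups. Polynomiality in time and point jointly
  provides the chain rule and a finite expansion in \<open>s\<close> whose coefficients are
  polynomial in the point.\<close>

definition poly_family :: "(complex \<Rightarrow> complex \<times> complex \<Rightarrow> complex \<times> complex) \<Rightarrow> bool" where
  "poly_family \<gamma> \<longleftrightarrow> (\<forall>s. \<gamma> s \<in> shear_slide_words) \<and> \<gamma> 0 = id \<and>
    poly_fun space_coords (\<lambda>(s, z). fst (\<gamma> s z)) \<and> poly_fun space_coords (\<lambda>(s, z). snd (\<gamma> s z))"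

text \<open>The vector field \<open>f\<^sub>y \<partial>\<^sub>x - f\<^sub>x \<partial>\<^sub>y\<close> of the Hamiltonian \<open>f\<close> is the velocity of \<open>\<gamma>\<close> at time \<open>0\<close>.\<close>

definition hamiltonian_velocity ::
    "(complex \<Rightarrow> complex \<times> complex \<Rightarrow> complex \<times> complex) \<Rightarrow> (complex \<times> complex \<Rightarrow> complex) \<Rightarrow> (complex \<times> complex \<Rightarrow> complex) \<Rightarrow> bool" where
  "hamiltonian_velocity \<gamma> fx fy \<longleftrightarrow> (\<forall>z.
    ((\<lambda>s. fst (\<gamma> s z)) has_field_derivative fy z) (at 0) \<and>
    ((\<lambda>s. snd (\<gamma> s z)) has_field_derivative - fx z) (at 0))"

lemma hamiltonian_velocityD:
  assumes "hamiltonian_velocity \<gamma> fx fy"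
  shows "((\<lambda>s. fst (\<gamma> s z)) has_field_derivative fy z) (at 0)"
    "((\<lambda>s. snd (\<gamma> s z)) has_field_derivative - fx z) (at 0)"
  using assms unfolding hamiltonian_velocity_def by blast+

text \<open>A stand-in for the Lie algebra of the group, written with functions instead of vector
  fields: conjugation becomes composition, and the Lie bracket becomes the Poisson bracket.\<close>

definition tangent_hamiltonians :: "(complex \<times> complex \<Rightarrow> complex) set" where
  "tangent_hamiltonians = {f. poly_fun plane_coords f \<and>
    (\<exists>\<gamma> fx fy. poly_family \<gamma> \<and> has_gradient f fx fy \<and> hamiltonian_velocity \<gamma> fx fy)}"

lemma tangent_hamiltonianE:
  assumes "f \<in> tangent_hamiltonians" "has_gradient f fx fy"
  obtains \<gamma> where "poly_family \<gamma>" "hamiltonian_velocity \<gamma> fx fy"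
  using assms has_gradient_unique unfolding tangent_hamiltonians_def by blast

lemma poly_fun_family_comp:
  assumes "poly_fun space_coords (\<lambda>(s, z). fst (\<gamma> s z))" "poly_fun space_coords (\<lambda>(s, z). snd (\<gamma> s z))"
    and "poly_fun space_coords (\<lambda>(s, z). fst (\<delta> s z))" "poly_fun space_coords (\<lambda>(s, z). snd (\<delta> s z))"
  shows "poly_fun space_coords (\<lambda>(s, z). fst (\<gamma> s (\<delta> s z)))" "poly_fun space_coords (\<lambda>(s, z). snd (\<gamma> s (\<delta> s z)))"
proof -
  have "poly_fun space_coords (\<lambda>z. c ((\<lambda>(s, z). (s, \<delta> s z)) z))" if "c \<in> space_coords" for c
    using that assms(3,4) by (auto simp: case_prod_unfold intro: poly_fun.coord)
  from poly_fun_comp[where \<phi> = "\<lambda>(s, z). (s, \<delta> s z)", OF assms(1) this]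
    poly_fun_comp[where \<phi> = "\<lambda>(s, z). (s, \<delta> s z)", OF assms(2) this]
  show "poly_fun space_coords (\<lambda>(s, z). fst (\<gamma> s (\<delta> s z)))" "poly_fun space_coords (\<lambda>(s, z). snd (\<gamma> s (\<delta> s z)))"
    by (auto simp: case_prod_unfold)
qed

lemma poly_family_comp:
  "poly_family \<gamma> \<Longrightarrow> poly_family \<delta> \<Longrightarrow> poly_family (\<lambda>s. \<gamma> s \<circ> \<delta> s)"
  unfolding poly_family_def using poly_fun_family_comp[of \<gamma> \<delta>] by (auto intro: words_comp)

text \<open>At time 0 the function \<open>P\<close> is a coordinate, with partial derivatives 0 and
  1 in the point. Moving time thus contributes \<open>d\<close> and moving the point contributes the
  velocity of that coordinate, with no cross term.\<close>

lemma poly_fun_at_0_derivative: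
  assumes P: "poly_fun space_coords P" and P0: "\<And>z. P (0, z) = c z" and c: "c \<in> plane_coords"
    and "((\<lambda>s. P (s, z)) has_field_derivative d) (at 0)"
    and w: "w 0 = z" "\<And>c. c \<in> plane_coords \<Longrightarrow> ((\<lambda>s. c (w s)) has_field_derivative w' c) (at 0)"
  shows "((\<lambda>s. P (s, w s)) has_field_derivative d + w' c) (at 0)"
proof -
  obtain a where a: "\<And>u u'. u 0 = (0, z) \<Longrightarrow>
      (\<And>k. k \<in> space_coords \<Longrightarrow> ((\<lambda>s. k (u s)) has_field_derivative u' k) (at 0)) \<Longrightarrow>
      ((\<lambda>s. P (u s)) has_field_derivative (\<Sum>k\<in>space_coords. a k * u' k)) (at 0)"
    by (rule poly_fun_curve_derivative[OF _ P, of "(0, z)"]) auto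
  define a0 a1 a2 where "a0 = a fst" "a1 = a (\<lambda>p. fst (snd p))" "a2 = a (\<lambda>p. snd (snd p))"
  \<comment> \<open>The chain rule with time and point moving independently. Moving time alone gives
    \<open>a0 = d\<close>; moving the point alone at time 0, where \<open>P\<close> is
    \<open>c\<close>, gives \<open>a1\<close> and \<open>a2\<close>.\<close>
  have b: "((\<lambda>s. P (t s, u s)) has_field_derivative a0 * t' + a1 * p' + a2 * q') (at 0)"
    if "t 0 = 0" "u 0 = z" "(t has_field_derivative t') (at 0)"
      "((\<lambda>s. fst (u s)) has_field_derivative p') (at 0)" "((\<lambda>s. snd (u s)) has_field_derivative q') (at 0)"
    for t u t' p' q'
  proof -
    define u' where "u' k = (if k = fst then t' else if k = (\<lambda>p. fst (snd p)) then p' else q')"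
      for k :: "complex \<times> complex \<times> complex \<Rightarrow> complex"
    have "((\<lambda>s. k (t s, u s)) has_field_derivative u' k) (at 0)" if "k \<in> space_coords" for k
      using that \<open>(t has_field_derivative t') (at 0)\<close> \<open>((\<lambda>s. fst (u s)) has_field_derivative p') (at 0)\<close>
        \<open>((\<lambda>s. snd (u s)) has_field_derivative q') (at 0)\<close> space_coords_distinct space_coords_distinct[symmetric]
      by (auto simp: u'_def)
    from a[where u = "\<lambda>s. (t s, u s)" and u' = u', OF _ this] that(1,2) show ?thesis
      using space_coords_distinct space_coords_distinct[symmetric]
      by (auto simp: a0_a1_a2_def add.assoc u'_def)
  qed
  have "a0 = d"
    using b[of "\<lambda>s. s" "\<lambda>_. z" 1 0 0] assms(4) by (auto dest: DERIV_unique)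
  have ids: "((\<lambda>s. k + s) has_field_derivative 1) (at 0)" "((\<lambda>s. k) has_field_derivative 0) (at 0)" for k :: complex
    by (auto intro!: derivative_eq_intros)
  have x: "((\<lambda>s. c (fst z + s, snd z)) has_field_derivative a1) (at 0)"
    using b[of "\<lambda>_. 0" "\<lambda>s. (fst z + s, snd z)" 0 1 0] ids by (auto simp: P0)
  have y: "((\<lambda>s. c (fst z, snd z + s)) has_field_derivative a2) (at 0)"
    using b[of "\<lambda>_. 0" "\<lambda>s. (fst z, snd z + s)" 0 0 1] ids by (auto simp: P0)
  have "a1 * w' fst + a2 * w' snd = w' c"
  proof (cases "c = fst")
    case True
    then have "a1 = 1" "a2 = 0" using DERIV_unique[OF x] DERIV_unique[OF y] ids by auto
    with True show ?thesis by simp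
  next
    case False
    then have "c = snd" using c by simp
    then have "a1 = 0" "a2 = 1" using DERIV_unique[OF x] DERIV_unique[OF y] ids by auto
    with \<open>c = snd\<close> show ?thesis by simp
  qed
  with b[of "\<lambda>s. s" w 1 "w' fst" "w' snd"] w \<open>a0 = d\<close> show ?thesis by (simp add: add.assoc)
qed

text \<open>Both families are the identity at \<open>s = 0\<close>, so to first order composing them
  adds their velocities.\<close>

lemma hamiltonian_velocity_comp:
  assumes "poly_family \<gamma>" "poly_family \<delta>" "hamiltonian_velocity \<gamma> fx fy" "hamiltonian_velocity \<delta> gx gy"
  shows "hamiltonian_velocity (\<lambda>s. \<gamma> s \<circ> \<delta> s) (\<lambda>z. fx z + gx z) (\<lambda>z. fy z + gy z)"
  unfolding hamiltonian_velocity_def o_def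
proof (intro allI conjI)
  fix z
  have \<delta>: "((\<lambda>s. c (\<delta> s z)) has_field_derivative (if c = fst then gy z else - gx z)) (at 0)" if "c \<in> plane_coords" for c
    using that hamiltonian_velocityD[OF assms(4), of z] plane_coords_distinct by auto
  have \<delta>0: "\<delta> 0 z = z" and \<gamma>0: "\<gamma> 0 = id" using assms(1,2) by (auto simp: poly_family_def)
  show "((\<lambda>s. fst (\<gamma> s (\<delta> s z))) has_field_derivative fy z + gy z) (at 0)"
    using poly_fun_at_0_derivative[of "\<lambda>(s, z). fst (\<gamma> s z)" fst z "fy z" "\<lambda>s. \<delta> s z", OF _ _ _ _ \<delta>0 \<delta>]
      assms(1) hamiltonian_velocityD[OF assms(3), of z] \<gamma>0
    by (auto simp: poly_family_def)
  show "((\<lambda>s. snd (\<gamma> s (\<delta> s z))) has_field_derivative - (fx z + gx z)) (at 0)"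
    using poly_fun_at_0_derivative[of "\<lambda>(s, z). snd (\<gamma> s z)" snd z "- fx z" "\<lambda>s. \<delta> s z", OF _ _ _ _ \<delta>0 \<delta>]
      assms(1) hamiltonian_velocityD[OF assms(3), of z] \<gamma>0
      plane_coords_distinct
    by (auto simp: poly_family_def)
qed

lemma tangent_hamiltonians_add:
  assumes "f \<in> tangent_hamiltonians" "g \<in> tangent_hamiltonians"
  shows "(\<lambda>z. f z + g z) \<in> tangent_hamiltonians"
  using assms unfolding tangent_hamiltonians_def
  by (auto intro: poly_fun.add) (blast intro: poly_family_comp hamiltonian_velocity_comp has_gradient_add)

text \<open>Running the family at speed \<open>c\<close> scales its velocity.\<close>

lemma tangent_hamiltonians_cmult:
  assumes "f \<in> tangent_hamiltonians"
  shows "(\<lambda>z. c * f z) \<in> tangent_hamiltonians"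
proof -
  obtain \<gamma> fx fy where \<gamma>: "poly_fun plane_coords f" "poly_family \<gamma>" "has_gradient f fx fy" "hamiltonian_velocity \<gamma> fx fy"
    using assms unfolding tangent_hamiltonians_def by blast
  have "poly_fun space_coords (\<lambda>z. k ((\<lambda>(s, z). (c * s, z)) z))" if "k \<in> space_coords" for k
    using that by (auto simp: case_prod_unfold intro: poly_fun.coord intro!: poly_fun_cmult)
  from poly_fun_comp[where \<phi> = "\<lambda>(s, z). (c * s, z)", OF _ this] \<gamma>(2) have "poly_family (\<lambda>s. \<gamma> (c * s))"
    unfolding poly_family_def case_prod_unfold by fastforce
  moreover have "hamiltonian_velocity (\<lambda>s. \<gamma> (c * s)) (\<lambda>z. c * fx z) (\<lambda>z. c * fy z)"
    unfolding hamiltonian_velocity_def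
  proof (intro allI conjI)
    fix z
    have lin: "((\<lambda>s. c * s) has_field_derivative c) (at 0)" by (auto intro!: derivative_eq_intros)
    have "((\<lambda>s. fst (\<gamma> s z)) has_field_derivative fy z) (at (c * 0))"
      "((\<lambda>s. snd (\<gamma> s z)) has_field_derivative - fx z) (at (c * 0))"
      using hamiltonian_velocityD[OF \<gamma>(4)] by auto
    from DERIV_chain2[where g = "\<lambda>s. c * s" and f = "\<lambda>s. fst (\<gamma> s z)", OF this(1) lin]
      DERIV_chain2[where g = "\<lambda>s. c * s" and f = "\<lambda>s. snd (\<gamma> s z)", OF this(2) lin]
    show "((\<lambda>s. fst (\<gamma> (c * s) z)) has_field_derivative c * fy z) (at 0)"
      "((\<lambda>s. snd (\<gamma> (c * s) z)) has_field_derivative - (c * fx z)) (at 0)"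
      by (simp_all add: mult.commute)
  qed
  ultimately show ?thesis
    using \<gamma>(1) has_gradient_cmult[OF \<gamma>(3)] unfolding tangent_hamiltonians_def by (blast intro: poly_fun_cmult)
qed

lemma poly_fun_fst: "poly_fun plane_coords fst" and poly_fun_snd: "poly_fun plane_coords snd"
  by (auto intro: poly_fun.coord)

lemma poly_fun_shear: "poly_fun plane_coords (\<lambda>z. fst (shear \<alpha> z))" "poly_fun plane_coords (\<lambda>z. snd (shear \<alpha> z))"
  by (auto simp: shear_def case_prod_unfold intro!: poly_fun_intros poly_fun_fst poly_fun_snd)

lemma poly_fun_slide: "poly_fun plane_coords (\<lambda>z. fst (slide \<alpha> z))" "poly_fun plane_coords (\<lambda>z. snd (slide \<alpha> z))"
  by (auto simp: slide_def case_prod_unfold intro!: poly_fun_intros poly_fun_fst poly_fun_snd)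

lemma poly_family_conj:
  assumes "poly_family \<gamma>" and "g \<in> shear_slide_words" "h \<in> shear_slide_words" "h \<circ> g = id"
    and "poly_fun plane_coords (\<lambda>z. fst (g z))" "poly_fun plane_coords (\<lambda>z. snd (g z))"
    and "poly_fun plane_coords (\<lambda>z. fst (h z))" "poly_fun plane_coords (\<lambda>z. snd (h z))"
  shows "poly_family (\<lambda>s. h \<circ> \<gamma> s \<circ> g)"
proof -
  have lift: "poly_fun space_coords (\<lambda>(s, z). k z)" if "poly_fun plane_coords k" for k
    using poly_fun_comp[OF that, of space_coords "\<lambda>(s, z). z"]
    by (auto simp: case_prod_unfold intro: poly_fun.coord)
  have \<gamma>: "poly_fun space_coords (\<lambda>(s, z). fst (\<gamma> s z))" "poly_fun space_coords (\<lambda>(s, z). snd (\<gamma> s z))"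
    using assms(1) by (auto simp: poly_family_def)
  note 1 = poly_fun_family_comp[of \<gamma> "\<lambda>_. g", OF \<gamma> lift[OF assms(5)] lift[OF assms(6)]]
  note 2 = poly_fun_family_comp[of "\<lambda>_. h", OF lift[OF assms(7)] lift[OF assms(8)] 1]
  show ?thesis
    using 2 assms(1-4) by (auto simp: poly_family_def intro!: words_comp)
qed

text \<open>The shear has Jacobian determinant 1, so it pulls the Hamiltonian field of
  \<open>f\<close> back to that of \<open>f \<circ> shear \<alpha>\<close>; conjugating the family
  realises this field. The term with \<open>2 * \<alpha> * snd z\<close> comes from differentiating
  y^2.\<close>

lemma tangent_hamiltonians_shear:
  assumes "f \<in> tangent_hamiltonians"
  shows "f \<circ> shear \<alpha> \<in> tangent_hamiltonians"
proof -
  obtain \<gamma> fx fy where \<gamma>: "poly_fun plane_coords f" "poly_family \<gamma>" "has_gradient f fx fy" "hamiltonian_velocity \<gamma> fx fy"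
    using assms unfolding tangent_hamiltonians_def by blast
  have "poly_fun plane_coords (f \<circ> shear \<alpha>)"
    unfolding o_def using poly_fun_shear by (intro poly_fun_comp[OF \<gamma>(1)]) auto
  moreover have "poly_family (\<lambda>s. shear (- \<alpha>) \<circ> \<gamma> s \<circ> shear \<alpha>)"
    by (intro poly_family_conj \<gamma> poly_fun_shear shear_in_words) (simp add: shear_add shear_0)
  moreover have "has_gradient (f \<circ> shear \<alpha>) (\<lambda>z. fx (shear \<alpha> z))
      (\<lambda>z. 2 * \<alpha> * snd z * fx (shear \<alpha> z) + fy (shear \<alpha> z))"
    unfolding has_gradient_def
  proof (intro allI impI)
    fix w :: "complex \<Rightarrow> complex \<times> complex" and a b
    assume w: "((\<lambda>s. fst (w s)) has_field_derivative a) (at 0)" "((\<lambda>s. snd (w s)) has_field_derivative b) (at 0)"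
    have "((\<lambda>s. fst (shear \<alpha> (w s))) has_field_derivative a + \<alpha> * (2 * snd (w 0) * b)) (at 0)"
      "((\<lambda>s. snd (shear \<alpha> (w s))) has_field_derivative b) (at 0)"
      using w by (auto simp: shear_def case_prod_unfold intro!: derivative_eq_intros)
    from has_gradientD[OF \<gamma>(3) this]
    show "((\<lambda>s. (f \<circ> shear \<alpha>) (w s)) has_field_derivative fx (shear \<alpha> (w 0)) * a +
        (2 * \<alpha> * snd (w 0) * fx (shear \<alpha> (w 0)) + fy (shear \<alpha> (w 0))) * b) (at 0)"
      by (simp add: algebra_simps)
  qed
  moreover have "hamiltonian_velocity (\<lambda>s. shear (- \<alpha>) \<circ> \<gamma> s \<circ> shear \<alpha>) (\<lambda>z. fx (shear \<alpha> z))
      (\<lambda>z. 2 * \<alpha> * snd z * fx (shear \<alpha> z) + fy (shear \<alpha> z))"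
    unfolding hamiltonian_velocity_def
  proof (intro allI)
    fix z
    have "((\<lambda>s. fst (\<gamma> s (shear \<alpha> z))) has_field_derivative fy (shear \<alpha> z)) (at 0)"
      "((\<lambda>s. snd (\<gamma> s (shear \<alpha> z))) has_field_derivative - fx (shear \<alpha> z)) (at 0)"
      "\<gamma> 0 (shear \<alpha> z) = shear \<alpha> z" "snd (shear \<alpha> z) = snd z"
      using hamiltonian_velocityD[OF \<gamma>(4)] \<gamma>(2) by (auto simp: poly_family_def shear_def case_prod_unfold)
    then show "((\<lambda>s. fst ((shear (- \<alpha>) \<circ> \<gamma> s \<circ> shear \<alpha>) z)) has_field_derivative
          2 * \<alpha> * snd z * fx (shear \<alpha> z) + fy (shear \<alpha> z)) (at 0) \<and>
        ((\<lambda>s. snd ((shear (- \<alpha>) \<circ> \<gamma> s \<circ> shear \<alpha>) z)) has_field_derivative - fx (shear \<alpha> z)) (at 0)"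
      unfolding shear_def[of "- \<alpha>"] by (auto simp: case_prod_unfold intro!: derivative_eq_intros)
  qed
  ultimately show ?thesis unfolding tangent_hamiltonians_def by blast
qed

text \<open>As for the shear; the term with \<open>\<beta>\<close> comes from the off-diagonal entry
  of the triangular Jacobian.\<close>

lemma tangent_hamiltonians_slide:
  assumes "f \<in> tangent_hamiltonians"
  shows "f \<circ> slide \<beta> \<in> tangent_hamiltonians"
proof -
  obtain \<gamma> fx fy where \<gamma>: "poly_fun plane_coords f" "poly_family \<gamma>" "has_gradient f fx fy" "hamiltonian_velocity \<gamma> fx fy"
    using assms unfolding tangent_hamiltonians_def by blast
  have "poly_fun plane_coords (f \<circ> slide \<beta>)"
    unfolding o_def using poly_fun_slide by (intro poly_fun_comp[OF \<gamma>(1)]) auto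
  moreover have "poly_family (\<lambda>s. slide (- \<beta>) \<circ> \<gamma> s \<circ> slide \<beta>)"
    by (intro poly_family_conj \<gamma> poly_fun_slide slide_in_words) (simp add: slide_add slide_0)
  moreover have "has_gradient (f \<circ> slide \<beta>) (\<lambda>z. fx (slide \<beta> z) - \<beta> * fy (slide \<beta> z)) (\<lambda>z. fy (slide \<beta> z))"
    unfolding has_gradient_def
  proof (intro allI impI)
    fix w :: "complex \<Rightarrow> complex \<times> complex" and a b
    assume w: "((\<lambda>s. fst (w s)) has_field_derivative a) (at 0)" "((\<lambda>s. snd (w s)) has_field_derivative b) (at 0)"
    have "((\<lambda>s. fst (slide \<beta> (w s))) has_field_derivative a) (at 0)"
      "((\<lambda>s. snd (slide \<beta> (w s))) has_field_derivative b - \<beta> * a) (at 0)"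
      using w by (auto simp: slide_def case_prod_unfold intro!: derivative_eq_intros)
    from has_gradientD[OF \<gamma>(3) this]
    show "((\<lambda>s. (f \<circ> slide \<beta>) (w s)) has_field_derivative
        (fx (slide \<beta> (w 0)) - \<beta> * fy (slide \<beta> (w 0))) * a + fy (slide \<beta> (w 0)) * b) (at 0)"
      by (simp add: algebra_simps)
  qed
  moreover have "hamiltonian_velocity (\<lambda>s. slide (- \<beta>) \<circ> \<gamma> s \<circ> slide \<beta>)
      (\<lambda>z. fx (slide \<beta> z) - \<beta> * fy (slide \<beta> z)) (\<lambda>z. fy (slide \<beta> z))"
    unfolding hamiltonian_velocity_def
  proof (intro allI)
    fix z
    have "((\<lambda>s. fst (\<gamma> s (slide \<beta> z))) has_field_derivative fy (slide \<beta> z)) (at 0)"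
      "((\<lambda>s. snd (\<gamma> s (slide \<beta> z))) has_field_derivative - fx (slide \<beta> z)) (at 0)"
      using hamiltonian_velocityD[OF \<gamma>(4)] by auto
    then show "((\<lambda>s. fst ((slide (- \<beta>) \<circ> \<gamma> s \<circ> slide \<beta>) z)) has_field_derivative fy (slide \<beta> z)) (at 0) \<and>
        ((\<lambda>s. snd ((slide (- \<beta>) \<circ> \<gamma> s \<circ> slide \<beta>) z)) has_field_derivative
          - (fx (slide \<beta> z) - \<beta> * fy (slide \<beta> z))) (at 0)"
      unfolding slide_def[of "- \<beta>"] by (auto simp: case_prod_unfold intro!: derivative_eq_intros)
  qed
  ultimately show ?thesis unfolding tangent_hamiltonians_def by blast
qed

lemma tangent_hamiltonians_words:
  "g \<in> shear_slide_words \<Longrightarrow> f \<in> tangent_hamiltonians \<Longrightarrow> f \<circ> g \<in> tangent_hamiltonians"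
proof (induction arbitrary: f rule: shear_slide_words.induct)
  case (shear g \<alpha>)
  then show ?case using tangent_hamiltonians_shear by (simp only: comp_assoc[symmetric])
next
  case (slide g \<beta>)
  then show ?case using tangent_hamiltonians_slide by (simp only: comp_assoc[symmetric])
qed simp

section \<open>Poisson brackets\<close>

text \<open>Vandermonde elimination without determinants: the values at \<open>s\<close> and
  \<open>2 * s\<close> together remove the top coefficient, and induction on \<open>N\<close>
  handles the rest.\<close>

lemma subspace_coefficients:
  assumes add: "\<And>f g. f \<in> V \<Longrightarrow> g \<in> V \<Longrightarrow> (\<lambda>z. f z + g z) \<in> V"
    and cmult: "\<And>c f. f \<in> V \<Longrightarrow> (\<lambda>z. c * f z) \<in> V"
    and "\<And>s :: complex. (\<lambda>z. \<Sum>k\<le>N. c k z * s ^ k) \<in> V" and "k \<le> N"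
  shows "c k \<in> V"
  using assms(3,4)
proof (induction N arbitrary: c k)
  case 0
  from "0.prems"(1)[of 0] "0.prems"(2) show ?case by simp
next
  case (Suc N)
  define v where "v s z = (\<Sum>k\<le>Suc N. c k z * s ^ k)" for s z
  have v: "v s \<in> V" for s using Suc.prems(1)[of s] unfolding v_def .
  have low: "c k \<in> V" if "k \<le> N" for k
  proof -
    \<comment> \<open>Subtracting \<open>2 ^ Suc N\<close> times the value at \<open>s\<close> from
      the value at \<open>2 * s\<close> multiplies the j-th coefficient by \<open>d j\<close>, which
      is 0 for \<open>j = Suc N\<close> and nonzero below.\<close>
    define d where "d j = (2 ^ j - 2 ^ Suc N :: complex)" for j
    have "(\<lambda>z. \<Sum>j\<le>N. (d j * c j z) * s ^ j) \<in> V" for s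
    proof -
      have "(\<lambda>z. v (2 * s) z + (- (2 ^ Suc N)) * v s z) \<in> V" by (intro add cmult v)
      moreover have "v (2 * s) z + (- (2 ^ Suc N)) * v s z = (\<Sum>j\<le>N. (d j * c j z) * s ^ j)" for z
      proof -
        have "v (2 * s) z + (- (2 ^ Suc N)) * v s z = (\<Sum>j\<le>Suc N. (d j * c j z) * s ^ j)"
          unfolding v_def sum_distrib_left sum.distrib[symmetric]
          by (intro sum.cong refl) (simp add: d_def algebra_simps power_mult_distrib)
        then show ?thesis by (simp add: d_def)
      qed
      ultimately show ?thesis by simp
    qed
    then have "(\<lambda>z. d k * c k z) \<in> V" using Suc.IH[of "\<lambda>j z. d j * c j z"] that by blast
    then have "(\<lambda>z. inverse (d k) * (d k * c k z)) \<in> V" by (rule cmult)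
    moreover have "d k \<noteq> 0"
    proof -
      have "(2::nat) ^ k < 2 ^ Suc N" using that by (intro power_strict_increasing) auto
      then have "of_nat (2 ^ k) \<noteq> (of_nat (2 ^ Suc N) :: complex)" by (simp only: of_nat_eq_iff)
      then show ?thesis by (simp add: d_def)
    qed
    ultimately show ?thesis by (simp add: field_simps)
  qed
  show ?case
  proof (cases "k \<le> N")
    case True
    then show ?thesis by (rule low)
  next
    case False
    then have k: "k = Suc N" using Suc.prems by simp
    have zero: "(\<lambda>_. 0) \<in> V" using cmult[OF v[of 0], of 0] by simp
    have "(\<lambda>z. \<Sum>j\<in>J. c j z) \<in> V" if "finite J" "J \<subseteq> {..N}" for J
      using that by (induction rule: finite_induct) (auto intro: zero add low)
    then have "(\<lambda>z. v 1 z + (- 1) * (\<Sum>j\<le>N. c j z)) \<in> V" by (intro add cmult v) auto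
    then show ?thesis by (simp add: v_def k)
  qed
qed

text \<open>The degree bound \<open>N\<close> is common to all \<open>z\<close>, so one finite list
  of coefficient functions describes \<open>P\<close> as a polynomial in time.\<close>

lemma poly_fun_expand_first:
  assumes "poly_fun space_coords P"
  obtains Q N where "\<And>z. degree (Q z) \<le> N" "\<And>s z. P (s, z) = poly (Q z) s"
    "\<And>k. poly_fun plane_coords (\<lambda>z. coeff (Q z) k)"
proof -
  have "\<exists>Q N. (\<forall>z. degree (Q z) \<le> N) \<and> (\<forall>s z. P (s, z) = poly (Q z) s) \<and>
      (\<forall>k. poly_fun plane_coords (\<lambda>z. coeff (Q z) k))"
    using assms
  proof induction
    case (const c)
    show ?case by (rule exI[of _ "\<lambda>_. [:c:]"]) (auto simp: coeff_pCons split: nat.splits intro: poly_fun.const)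
  next
    case (coord f)
    then consider "f = fst" | "f = (\<lambda>p. fst (snd p))" | "f = (\<lambda>p. snd (snd p))" by auto
    then show ?case
    proof cases
      case 1
      show ?thesis unfolding 1
        by (intro exI[of _ "\<lambda>_. [:0, 1:]"] exI[of _ 1])
          (auto simp: intro: poly_fun.const)
    next
      case 2
      have "poly_fun plane_coords (\<lambda>z. coeff [:fst z:] k)" for k
        by (cases k) (auto intro: poly_fun.const poly_fun_fst)
      then show ?thesis unfolding 2
        by (intro exI[of _ "\<lambda>z. [:fst z:]"] exI[of _ 0]) auto
    next
      case 3
      have "poly_fun plane_coords (\<lambda>z. coeff [:snd z:] k)" for k
        by (cases k) (auto intro: poly_fun.const poly_fun_snd)
      then show ?thesis unfolding 3
        by (intro exI[of _ "\<lambda>z. [:snd z:]"] exI[of _ 0]) auto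
    qed
  next
    case (add f g)
    from add.IH(1) obtain Q N where Q: "\<And>z. degree (Q z) \<le> N" "\<And>s z. f (s, z) = poly (Q z) s"
      "\<And>k. poly_fun plane_coords (\<lambda>z. coeff (Q z) k)" by blast
    from add.IH(2) obtain R M where R: "\<And>z. degree (R z) \<le> M" "\<And>s z. g (s, z) = poly (R z) s"
      "\<And>k. poly_fun plane_coords (\<lambda>z. coeff (R z) k)" by blast
    have "degree (Q z + R z) \<le> max N M" for z
      using Q(1)[of z] R(1)[of z] by (intro degree_add_le) auto
    then show ?case
      by (intro exI[of _ "\<lambda>z. Q z + R z"] exI[of _ "max N M"]) (simp add: Q R poly_fun.add)
  next
    case (mult f g)
    from mult.IH(1) obtain Q N where Q: "\<And>z. degree (Q z) \<le> N" "\<And>s z. f (s, z) = poly (Q z) s"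
      "\<And>k. poly_fun plane_coords (\<lambda>z. coeff (Q z) k)" by blast
    from mult.IH(2) obtain R M where R: "\<And>z. degree (R z) \<le> M" "\<And>s z. g (s, z) = poly (R z) s"
      "\<And>k. poly_fun plane_coords (\<lambda>z. coeff (R z) k)" by blast
    have "degree (Q z * R z) \<le> N + M" for z
      using degree_mult_le[of "Q z" "R z"] Q(1)[of z] R(1)[of z] by linarith
    then show ?case
      by (intro exI[of _ "\<lambda>z. Q z * R z"] exI[of _ "N + M"])
        (auto simp: Q R coeff_mult intro!: poly_fun_sum poly_fun.mult)
  qed
  then show ?thesis using that by blast
qed

text \<open>The family of \<open>g\<close> has velocity \<open>(gy, - gx)\<close>, so the chain rule
  identifies the coefficient of \<open>s\<close> in \<open>f (\<gamma> s z)\<close>. Moving along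
  \<open>g\<close> and not along \<open>f\<close> fixes the sign.\<close>

lemma tangent_hamiltonians_bracket:
  assumes f: "f \<in> tangent_hamiltonians" and g: "g \<in> tangent_hamiltonians"
    and df: "has_gradient f fx fy" and dg: "has_gradient g gx gy"
  shows "(\<lambda>z. fx z * gy z - fy z * gx z) \<in> tangent_hamiltonians"
proof -
  obtain \<gamma> where \<gamma>: "poly_family \<gamma>" "hamiltonian_velocity \<gamma> gx gy"
    using g dg by (rule tangent_hamiltonianE)
  have "poly_fun space_coords (\<lambda>(s, z). f (\<gamma> s z))"
    using \<gamma>(1) f poly_fun_comp[where f = f and \<phi> = "\<lambda>(s, z). \<gamma> s z" and D = space_coords and C = plane_coords]
    by (auto simp: poly_family_def tangent_hamiltonians_def case_prod_unfold)
  then obtain Q N where Q: "\<And>z. degree (Q z) \<le> N" "\<And>s z. f (\<gamma> s z) = poly (Q z) s"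
    by (rule poly_fun_expand_first) auto
  \<comment> \<open>The range ends at \<open>Suc N\<close> so that the index 1 occurs even if
    \<open>N = 0\<close>.\<close>
  have "(\<lambda>z. \<Sum>k\<le>Suc N. coeff (Q z) k * s ^ k) \<in> tangent_hamiltonians" for s
  proof -
    have "poly (Q z) s = (\<Sum>k\<le>Suc N. coeff (Q z) k * s ^ k)" for z
      unfolding poly_altdef using Q(1)[of z]
      by (intro sum.mono_neutral_left) (auto simp: coeff_eq_0)
    moreover have "f \<circ> \<gamma> s \<in> tangent_hamiltonians"
      using f \<gamma>(1) by (intro tangent_hamiltonians_words) (auto simp: poly_family_def)
    ultimately show ?thesis by (simp add: o_def Q(2))
  qed
  then have "(\<lambda>z. coeff (Q z) 1) \<in> tangent_hamiltonians"
    using subspace_coefficients[where V = tangent_hamiltonians and N = "Suc N" and c = "\<lambda>k z. coeff (Q z) k" and k = 1]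
      tangent_hamiltonians_add tangent_hamiltonians_cmult by simp
  moreover have "coeff (Q z) 1 = fx z * gy z - fy z * gx z" for z
  proof -
    have "((\<lambda>s. f (\<gamma> s z)) has_field_derivative fx (\<gamma> 0 z) * gy z + fy (\<gamma> 0 z) * - gx z) (at 0)"
      using \<gamma> by (intro has_gradientD[OF df] hamiltonian_velocityD)
    then have "((\<lambda>s. poly (Q z) s) has_field_derivative fx z * gy z - fy z * gx z) (at 0)"
      using \<gamma>(1) by (simp add: Q(2) poly_family_def)
    from DERIV_unique[OF poly_DERIV this] show ?thesis
      by (simp add: poly_0_coeff_0 coeff_pderiv)
  qed
  ultimately show ?thesis by simp
qed

section \<open>All polynomials are tangent Hamiltonians\<close>

lemma const_tangent_hamiltonian: "(\<lambda>_. c) \<in> tangent_hamiltonians"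
proof -
  have "poly_family (\<lambda>_. id)"
    by (auto simp: poly_family_def case_prod_unfold intro: shear_slide_words.id poly_fun.coord)
  moreover have "hamiltonian_velocity (\<lambda>_. id) (\<lambda>_. 0) (\<lambda>_. 0)"
    by (auto simp: hamiltonian_velocity_def)
  ultimately show ?thesis
    using has_gradient_const[of c] unfolding tangent_hamiltonians_def by (blast intro: poly_fun.const)
qed

lemma shear_tangent_hamiltonian: "(\<lambda>z. snd z ^ 3) \<in> tangent_hamiltonians"
proof -
  \<comment> \<open>The factor 3 speeds up the shear, whose own Hamiltonian is y^3 / 3.\<close>
  have "poly_family (\<lambda>s. shear (3 * s))"
    unfolding poly_family_def
    by (auto simp: shear_0 shear_def case_prod_unfold shear_in_words[unfolded shear_def case_prod_unfold]
        intro!: poly_fun_intros intro: poly_fun.coord)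
  moreover have "has_gradient (\<lambda>z. snd z ^ 3) (\<lambda>z. 0) (\<lambda>z. 3 * snd z ^ 2)"
    using has_gradient_power[OF has_gradient_snd, of 3] by simp
  moreover have "hamiltonian_velocity (\<lambda>s. shear (3 * s)) (\<lambda>z. 0) (\<lambda>z. 3 * snd z ^ 2)"
    by (auto simp: hamiltonian_velocity_def shear_def intro!: derivative_eq_intros)
  ultimately show ?thesis
    unfolding tangent_hamiltonians_def by (blast intro: poly_fun_power poly_fun_snd)
qed

lemma slide_tangent_hamiltonian: "(\<lambda>z. (1 / 2) * fst z ^ 2 + snd z) \<in> tangent_hamiltonians"
proof -
  have "poly_family slide"
    unfolding poly_family_def
    by (auto simp: slide_0 slide_def case_prod_unfold slide_in_words[unfolded slide_def case_prod_unfold]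
        intro!: poly_fun_intros intro: poly_fun.coord)
  moreover have "has_gradient (\<lambda>z. (1 / 2) * fst z ^ 2 + snd z) (\<lambda>z. fst z) (\<lambda>z. 1)"
    using has_gradient_add[OF has_gradient_cmult[OF has_gradient_power[OF has_gradient_fst, of 2], of "1 / 2"] has_gradient_snd]
    by simp
  moreover have "hamiltonian_velocity slide (\<lambda>z. fst z) (\<lambda>z. 1)"
    by (auto simp: hamiltonian_velocity_def slide_def intro!: derivative_eq_intros)
  moreover have "poly_fun plane_coords (\<lambda>z. (1 / 2) * fst z ^ 2 + snd z)"
    by (intro poly_fun.add poly_fun_cmult poly_fun_power poly_fun_fst poly_fun_snd)
  ultimately show ?thesis
    unfolding tangent_hamiltonians_def by blast
qed

lemma has_gradient_monomial:
  "has_gradient (\<lambda>z. fst z ^ a * snd z ^ b)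
    (\<lambda>z. of_nat a * fst z ^ (a - 1) * snd z ^ b) (\<lambda>z. of_nat b * fst z ^ a * snd z ^ (b - 1))"
  using has_gradient_mult[OF has_gradient_power[OF has_gradient_fst] has_gradient_power[OF has_gradient_snd], of a b]
  by (simp add: algebra_simps)

text \<open>
  Bracketing \<open>y\<^sup>3\<close> repeatedly with \<open>x\<^sup>2/2 + y\<close> yields \<open>- 3 x y\<^sup>2\<close>, \<open>6 x\<^sup>2 y - 3 y\<^sup>2\<close>, \<open>18 x y - 6 x\<^sup>3\<close>,
  \<open>18 y - 36 x\<^sup>2\<close>, \<open>- 90 x\<close>. The bracket with \<open>x y\<^sup>2\<close> raises the powers of \<open>y\<close>, and the bracket with \<open>x\<^sup>2\<close>
  then turns powers of \<open>y\<close> into mixed monomials.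
\<close>

lemma monomial_tangent_hamiltonian: "(\<lambda>z. fst z ^ a * snd z ^ b) \<in> tangent_hamiltonians"
proof -
  let ?T = tangent_hamiltonians
  let ?h = "\<lambda>z :: complex \<times> complex. (1 / 2) * fst z ^ 2 + snd z"
  have dh: "has_gradient ?h fst (\<lambda>_. 1)"
    using has_gradient_add[OF has_gradient_cmult[OF has_gradient_power[OF has_gradient_fst, of 2], of "1 / 2"] has_gradient_snd]
    by simp
  \<comment> \<open>Bracketing with x^2 / 2 + y is the derivation d/dx - x d/dy. It lowers the
    weighted degree by one if x has weight 1 and y has weight 2, so five brackets lead from y^3, of
    weight 6, to a multiple of x.\<close>
  note br = tangent_hamiltonians_bracket[OF _ slide_tangent_hamiltonian _ dh]
  have 1: "(\<lambda>z. - 3 * (fst z * snd z ^ 2)) \<in> ?T"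
    using br[OF shear_tangent_hamiltonian has_gradient_power[OF has_gradient_snd]] by (simp add: algebra_simps)
  have 2: "(\<lambda>z. 6 * (fst z ^ 2 * snd z) + (- 3) * snd z ^ 2) \<in> ?T"
    using br[OF 1 has_gradient_cmult[OF has_gradient_monomial[of 1 2, simplified]]]
    by (simp add: algebra_simps power2_eq_square)
  have 3: "(\<lambda>z. 18 * (fst z * snd z) + (- 6) * fst z ^ 3) \<in> ?T"
    using br[OF 2 has_gradient_add[OF has_gradient_cmult[OF has_gradient_monomial[of 2 1, simplified]]
        has_gradient_cmult[OF has_gradient_power[OF has_gradient_snd, of 2]]]]
    by (simp add: algebra_simps power2_eq_square power3_eq_cube)
  have 4: "(\<lambda>z. 18 * snd z + (- 36) * fst z ^ 2) \<in> ?T"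
    using br[OF 3 has_gradient_add[OF has_gradient_cmult[OF has_gradient_monomial[of 1 1, simplified]]
        has_gradient_cmult[OF has_gradient_power[OF has_gradient_fst, of 3]]]]
    by (simp add: algebra_simps power2_eq_square)
  have 5: "(\<lambda>z. - 90 * fst z) \<in> ?T"
    using br[OF 4 has_gradient_add[OF has_gradient_cmult[OF has_gradient_snd]
        has_gradient_cmult[OF has_gradient_power[OF has_gradient_fst, of 2]]]]
    by (simp add: algebra_simps)
  have x: "fst \<in> ?T" using tangent_hamiltonians_cmult[OF 5, of "- 1 / 90"] by simp
  \<comment> \<open>In weight 2 two independent combinations of x^2 and y are now available: 18 y -
    36 x^2 - 18 (x^2 / 2 + y) = - 45 x^2.\<close>
  have xx: "(\<lambda>z. fst z ^ 2) \<in> ?T"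
  proof -
    have "(\<lambda>z. (- 1 / 54) * ((18 * snd z + (- 36) * fst z ^ 2) + (- 18) * ((1 / 2) * fst z ^ 2 + snd z))) \<in> ?T"
      by (intro tangent_hamiltonians_cmult tangent_hamiltonians_add 4 slide_tangent_hamiltonian)
    then have "(\<lambda>z. (45 / 54) * fst z ^ 2) \<in> ?T" by (simp add: algebra_simps)
    from tangent_hamiltonians_cmult[OF this, of "54 / 45"] show ?thesis by simp
  qed
  have y: "snd \<in> ?T"
    using tangent_hamiltonians_add[OF slide_tangent_hamiltonian tangent_hamiltonians_cmult[OF xx, of "- 1 / 2"]]
    by simp
  have xyy: "(\<lambda>z. fst z * snd z ^ 2) \<in> ?T"
    using tangent_hamiltonians_cmult[OF 1, of "- 1 / 3"] by simp
  \<comment> \<open>The bracket of x with y^3 is 3 y^2.\<close>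
  have yy: "(\<lambda>z. snd z ^ 2) \<in> ?T"
    using tangent_hamiltonians_cmult[OF tangent_hamiltonians_bracket[OF x shear_tangent_hamiltonian
        has_gradient_fst has_gradient_power[OF has_gradient_snd, of 3]], of "1 / 3"] by simp
  have high: "(\<lambda>z. snd z ^ (k + 3)) \<in> ?T" for k
  proof (induction k)
    case 0
    show ?case using shear_tangent_hamiltonian by simp
  next
    case (Suc k)
    from tangent_hamiltonians_cmult[OF tangent_hamiltonians_bracket[OF xyy Suc has_gradient_monomial[of 1 2, simplified]
        has_gradient_power[OF has_gradient_snd, of "k + 3"]], of "1 / of_nat (k + 3)"]
    have "(\<lambda>z. (1 / of_nat (k + 3)) * (snd z ^ 2 * (of_nat (k + 3) * snd z ^ (k + 2)))) \<in> ?T"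
      by (simp add: numeral_3_eq_3)
    moreover have "(1 / of_nat (k + 3)) * (u ^ 2 * (of_nat (k + 3) * u ^ (k + 2))) = u ^ (Suc k + 3)" for u :: complex
    proof -
      have "of_nat (k + 3) \<noteq> (0 :: complex)" by (simp only: of_nat_eq_0_iff)
      then have "(1 / of_nat (k + 3)) * (u ^ 2 * (of_nat (k + 3) * u ^ (k + 2))) = u ^ 2 * u ^ (k + 2)"
        by (simp add: field_simps)
      also have "\<dots> = u ^ (2 + (k + 2))" by (rule power_add[symmetric])
      also have "2 + (k + 2) = Suc k + 3" by simp
      finally show ?thesis .
    qed
    ultimately show ?case by simp
  qed
  have ypow: "(\<lambda>z. snd z ^ k) \<in> ?T" for k
  proof -
    consider "k = 0" | "k = 1" | "k = 2" | "k = (k - 3) + 3" by linarith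
    then show ?thesis
    proof cases
      case 4
      then have "(k - 3) + 3 = k" by simp
      with high[of "k - 3"] show ?thesis by (simp only:)
    qed (use const_tangent_hamiltonian[of 1] y yy in simp_all)
  qed
  show ?thesis
  proof (induction a arbitrary: b)
    case 0
    show ?case using ypow by simp
  next
    case (Suc a)
    have dxx: "has_gradient (\<lambda>z. fst z ^ 2) (\<lambda>z. 2 * fst z) (\<lambda>_. 0)"
      using has_gradient_power[OF has_gradient_fst, of 2] by simp
    \<comment> \<open>The bracket of x^a y^(b+1) with x^2 is - 2 (b + 1) x^(a+1) y^b. A factor y is
      traded for a factor x, which is why the induction on \<open>a\<close> keeps \<open>b\<close>
      arbitrary.\<close>
    have "(\<lambda>z. (- 1 / (2 * of_nat (Suc b))) * (of_nat a * fst z ^ (a - 1) * snd z ^ Suc b * 0 -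
        of_nat (Suc b) * fst z ^ a * snd z ^ (Suc b - 1) * (2 * fst z))) \<in> ?T"
      by (intro tangent_hamiltonians_cmult tangent_hamiltonians_bracket[OF Suc xx has_gradient_monomial dxx])
    moreover have "(- 1 / (2 * of_nat (Suc b))) * (of_nat a * u ^ (a - 1) * v ^ Suc b * 0 -
        of_nat (Suc b) * u ^ a * v ^ (Suc b - 1) * (2 * u)) = u ^ Suc a * v ^ b" for u v :: complex
    proof -
      have "of_nat (Suc b) \<noteq> (0 :: complex)" by (simp only: of_nat_eq_0_iff)
      then show ?thesis by (simp add: field_simps del: of_nat_Suc)
    qed
    ultimately show ?case by simp
  qed
qed

text \<open>Tangent Hamiltonians are closed under linear combinations, but closure under products is
  not at hand, so rule induction on \<open>poly_fun\<close> cannot target them directly. The span of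
  the monomials absorbs products.\<close>

inductive_set monomial_span :: "(complex \<times> complex \<Rightarrow> complex) set" where
  monomial: "(\<lambda>z. fst z ^ a * snd z ^ b) \<in> monomial_span"
| cmult: "f \<in> monomial_span \<Longrightarrow> (\<lambda>z. c * f z) \<in> monomial_span"
| add: "f \<in> monomial_span \<Longrightarrow> g \<in> monomial_span \<Longrightarrow> (\<lambda>z. f z + g z) \<in> monomial_span"

lemma poly_fun_tangent_hamiltonian:
  assumes "poly_fun plane_coords f"
  shows "f \<in> tangent_hamiltonians"
proof -
  have x: "(\<lambda>z. fst z * g z) \<in> monomial_span" if "g \<in> monomial_span" for g
    using that
  proof induction
    case (monomial a b)
    show ?case using monomial_span.monomial[of "Suc a" b] by (simp add: mult.assoc)
  next
    case (cmult f c)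
    then show ?case using monomial_span.cmult[of _ c] by (simp add: mult.left_commute)
  next
    case (add f g)
    then show ?case using monomial_span.add by (simp add: distrib_left)
  qed
  have y: "(\<lambda>z. snd z * g z) \<in> monomial_span" if "g \<in> monomial_span" for g
    using that
  proof induction
    case (monomial a b)
    show ?case using monomial_span.monomial[of a "Suc b"] by (simp add: mult.left_commute)
  next
    case (cmult f c)
    then show ?case using monomial_span.cmult[of _ c] by (simp add: mult.left_commute)
  next
    case (add f g)
    then show ?case using monomial_span.add by (simp add: distrib_left)
  qed
  \<comment> \<open>Carrying a factor \<open>g\<close> along reduces the product case to
    associativity; \<open>g = 1\<close> recovers \<open>f\<close>.\<close>
  have "(\<lambda>z. f z * g z) \<in> monomial_span" if "g \<in> monomial_span" for g
    using assms that
  proof (induction arbitrary: g)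
    case (const c)
    then show ?case by (rule monomial_span.cmult)
  next
    case (coord f)
    then show ?case using x y by auto
  next
    case (add f f')
    then show ?case using monomial_span.add by (simp add: distrib_right)
  next
    case (mult f f')
    then show ?case by (simp add: mult.assoc)
  qed
  from this[OF monomial_span.monomial[of 0 0]] have "f \<in> monomial_span" by simp
  then show ?thesis
    by induction (auto intro: monomial_tangent_hamiltonian tangent_hamiltonians_add tangent_hamiltonians_cmult)
qed

section \<open>Orbits of tuples\<close>

lemma poly_fun_separate:
  assumes "a \<noteq> (b :: complex \<times> complex)"
  obtains f where "poly_fun plane_coords f" "f a = 1" "f b = 0"
proof (cases "fst a = fst b")
  case True
  with assms have "snd a \<noteq> snd b" by (auto simp: prod_eq_iff)
  then show ?thesis
    by (intro that[of "\<lambda>z. (snd z - snd b) / (snd a - snd b)"] poly_fun_intros poly_fun_snd) auto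
next
  case False
  then show ?thesis
    by (intro that[of "\<lambda>z. (fst z - fst b) / (fst a - fst b)"] poly_fun_intros poly_fun_fst) auto
qed

text \<open>Take l h^2 with l affine of gradient (p, q) and l(a) = 0, and with h equal to 1 at
  \<open>a\<close> and 0 on \<open>B\<close>. At \<open>a\<close> only the gradient of l survives,
  and the double zeros of h^2 kill the gradient on \<open>B\<close>.\<close>

lemma poly_fun_prescribed_gradient:
  assumes "finite B" "a \<notin> B"
  obtains f fx fy where "poly_fun plane_coords f" "has_gradient f fx fy" "fx a = p" "fy a = q"
    "\<And>b. b \<in> B \<Longrightarrow> fx b = 0 \<and> fy b = 0"
proof -
  have "\<forall>b\<in>B. \<exists>f. poly_fun plane_coords f \<and> f a = 1 \<and> f b = 0"
  proof
    fix b assume "b \<in> B"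
    with assms(2) have "a \<noteq> b" by blast
    then show "\<exists>f. poly_fun plane_coords f \<and> f a = 1 \<and> f b = 0"
      by (rule poly_fun_separate) blast
  qed
  then obtain e where e: "\<And>b. b \<in> B \<Longrightarrow> poly_fun plane_coords (e b) \<and> e b a = 1 \<and> e b b = 0"
    unfolding bchoice_iff by blast
  define h where "h z = (\<Prod>b\<in>B. e b z)" for z
  have h: "poly_fun plane_coords h" "h a = 1" "\<And>b. b \<in> B \<Longrightarrow> h b = 0"
    using e assms(1) unfolding h_def by (auto intro!: poly_fun_prod prod.neutral prod_zero)
  obtain hx hy where dh: "has_gradient h hx hy" using poly_fun_has_gradient[OF h(1)] .
  define l where "l z = p * (fst z - fst a) + q * (snd z - snd a)" for z
  have l: "poly_fun plane_coords l"
    unfolding l_def by (intro poly_fun_intros poly_fun_fst poly_fun_snd)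
  have dl: "has_gradient l (\<lambda>_. p) (\<lambda>_. q)"
    unfolding has_gradient_def l_def by (auto intro!: derivative_eq_intros)
  have "l a = 0" by (simp add: l_def)
  then show ?thesis
    using h by (intro that[OF _ has_gradient_mult[OF dl has_gradient_mult[OF dh dh]]] poly_fun.mult l) auto
qed

lemma poly_family_prescribed_velocity:
  assumes "finite A" "a \<in> A"
  obtains \<gamma> where "poly_family \<gamma>"
    "\<And>b. b \<in> A \<Longrightarrow> ((\<lambda>s. fst (\<gamma> s b)) has_field_derivative (if b = a then u else 0)) (at 0)"
    "\<And>b. b \<in> A \<Longrightarrow> ((\<lambda>s. snd (\<gamma> s b)) has_field_derivative (if b = a then v else 0)) (at 0)"
proof -
  \<comment> \<open>The Hamiltonian field is \<open>(fy, - fx)\<close>, hence the targets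
    \<open>- v\<close> and \<open>u\<close>.\<close>
  obtain f fx fy where f: "poly_fun plane_coords f" "has_gradient f fx fy" "fx a = - v" "fy a = u"
    "\<And>b. b \<in> A - {a} \<Longrightarrow> fx b = 0 \<and> fy b = 0"
    using poly_fun_prescribed_gradient[of "A - {a}" a "- v" u] assms by auto
  obtain \<gamma> where \<gamma>: "poly_family \<gamma>" "hamiltonian_velocity \<gamma> fx fy"
    using poly_fun_tangent_hamiltonian[OF f(1)] f(2) by (rule tangent_hamiltonianE)
  have eq: "fy b = (if b = a then u else 0)" "- fx b = (if b = a then v else 0)" if "b \<in> A" for b
    using f(3-5) that by auto
  show ?thesis
  proof (rule that[OF \<gamma>(1)])
    fix b assume b: "b \<in> A"
    show "((\<lambda>s. fst (\<gamma> s b)) has_field_derivative (if b = a then u else 0)) (at 0)"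
      unfolding eq(1)[OF b, symmetric] by (rule hamiltonian_velocityD[OF \<gamma>(2)])
    show "((\<lambda>s. snd (\<gamma> s b)) has_field_derivative (if b = a then v else 0)) (at 0)"
      unfolding eq(2)[OF b, symmetric] by (rule hamiltonian_velocityD[OF \<gamma>(2)])
  qed
qed

text \<open>Composing the families with independent times gives a map whose derivative in
  \<open>t j\<close> at the origin is the velocity of \<open>\<gamma> j\<close>, since on the j-th
  axis all other factors are the identity. Conditions on \<open>t\<close> concern \<open>I\<close>
  only, so the induction can add one index at a time.\<close>

lemma poly_family_product:
  assumes "finite I" "\<And>j. j \<in> I \<Longrightarrow> poly_family (\<gamma> j)"
  obtains \<Phi> where "\<And>t. \<Phi> t \<in> shear_slide_words" "\<And>t. (\<forall>i\<in>I. t i = 0) \<Longrightarrow> \<Phi> t = id"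
    "\<And>t j. j \<in> I \<Longrightarrow> (\<forall>i\<in>I - {j}. t i = 0) \<Longrightarrow> \<Phi> t = \<gamma> j (t j)"
    "\<And>z. poly_fun {\<lambda>t. t i |i. i \<in> I} (\<lambda>t. fst (\<Phi> t z))"
    "\<And>z. poly_fun {\<lambda>t. t i |i. i \<in> I} (\<lambda>t. snd (\<Phi> t z))"
proof -
  have "\<exists>\<Phi>. (\<forall>t. \<Phi> t \<in> shear_slide_words) \<and> (\<forall>t. (\<forall>i\<in>I. t i = 0) \<longrightarrow> \<Phi> t = id) \<and>
    (\<forall>t. \<forall>j\<in>I. (\<forall>i\<in>I - {j}. t i = 0) \<longrightarrow> \<Phi> t = \<gamma> j (t j)) \<and>
    (\<forall>z. poly_fun {\<lambda>t. t i |i. i \<in> I} (\<lambda>t. fst (\<Phi> t z))) \<and>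
    (\<forall>z. poly_fun {\<lambda>t. t i |i. i \<in> I} (\<lambda>t. snd (\<Phi> t z)))"
    using assms
  proof (induction I)
    case empty
    show ?case by (intro exI[of _ "\<lambda>_. id"]) (simp add: shear_slide_words.id shear_slide_words.id[unfolded id_def] poly_fun.const)
  next
    case (insert k I)
    then have IH: "\<And>j. j \<in> I \<Longrightarrow> poly_family (\<gamma> j)" by blast
    from insert.IH[OF this] obtain \<Phi> where \<Phi>: "\<And>t. \<Phi> t \<in> shear_slide_words" "\<And>t. (\<forall>i\<in>I. t i = 0) \<Longrightarrow> \<Phi> t = id"
      "\<And>t j. j \<in> I \<Longrightarrow> (\<forall>i\<in>I - {j}. t i = 0) \<Longrightarrow> \<Phi> t = \<gamma> j (t j)"
      "\<And>z. poly_fun {\<lambda>t. t i |i. i \<in> I} (\<lambda>t. fst (\<Phi> t z))"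
      "\<And>z. poly_fun {\<lambda>t. t i |i. i \<in> I} (\<lambda>t. snd (\<Phi> t z))" by blast
    have \<gamma>: "\<And>s. \<gamma> k s \<in> shear_slide_words" "\<gamma> k 0 = id"
      "poly_fun space_coords (\<lambda>(s, z). fst (\<gamma> k s z))" "poly_fun space_coords (\<lambda>(s, z). snd (\<gamma> k s z))"
      using insert.prems[of k] by (auto simp: poly_family_def)
    define C where "C = {\<lambda>t :: 'a \<Rightarrow> complex. t i |i. i \<in> insert k I}"
    have sub: "{\<lambda>t. t i |i. i \<in> I} \<subseteq> C" and k: "poly_fun C (\<lambda>t. t k)"
      unfolding C_def by (blast, rule poly_fun.coord, blast)
    have c: "poly_fun C (\<lambda>t. c (t k, \<Phi> t z))" if "c \<in> space_coords" for c z
      using that k poly_fun_mono[OF \<Phi>(4)[of z] sub] poly_fun_mono[OF \<Phi>(5)[of z] sub] by auto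
    have "poly_fun C (\<lambda>t. fst (\<gamma> k (t k) (\<Phi> t z)))" "poly_fun C (\<lambda>t. snd (\<gamma> k (t k) (\<Phi> t z)))" for z
      using poly_fun_comp[where \<phi> = "\<lambda>t. (t k, \<Phi> t z)", OF \<gamma>(3) c]
        poly_fun_comp[where \<phi> = "\<lambda>t. (t k, \<Phi> t z)", OF \<gamma>(4) c] by auto
    moreover have "\<gamma> k (t k) \<circ> \<Phi> t = \<gamma> j (t j)" if "j \<in> insert k I" "\<forall>i\<in>insert k I - {j}. t i = 0" for t j
    proof (cases "j = k")
      case True
      then show ?thesis using that \<open>k \<notin> I\<close> \<Phi>(2)[of t] by auto
    next
      case False
      then show ?thesis using that \<Phi>(3)[of j t] \<gamma>(2) by auto
    qed
    moreover have "\<gamma> k (t k) \<circ> \<Phi> t \<in> shear_slide_words" for t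
      by (rule words_comp[OF \<gamma>(1) \<Phi>(1)])
    moreover have "\<gamma> k (t k) \<circ> \<Phi> t = id" if "\<forall>i\<in>insert k I. t i = 0" for t
      using that \<Phi>(2)[of t] \<gamma>(2) by simp
    ultimately show ?case
      unfolding C_def by (intro exI[of _ "\<lambda>t. \<gamma> k (t k) \<circ> \<Phi> t"] conjI allI ballI impI) (simp_all only: o_def)
  qed
  then show ?thesis using that by blast
qed

text \<open>The target is a map \<open>\<psi>\<close> on a finite set of points rather than a second
  list, which builds the distinctness of the starting tuple into the encoding.\<close>

lemma words_locally_transitive:
  assumes A: "finite A"
  obtains \<epsilon> :: real where "0 < \<epsilon>"
    "\<And>\<psi>. (\<And>a. a \<in> A \<Longrightarrow> norm (fst (\<psi> a) - fst a) < \<epsilon> \<and> norm (snd (\<psi> a) - snd a) < \<epsilon>) \<Longrightarrow>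
      \<exists>g\<in>shear_slide_words. \<forall>a\<in>A. g a = \<psi> a"
proof -
  \<comment> \<open>One parameter per point and coordinate: \<open>True\<close> moves x and
    \<open>False\<close> moves y.\<close>
  define I where "I = A \<times> (UNIV :: bool set)"
  have I: "finite I" using A by (simp add: I_def)
  have "\<forall>j\<in>I. \<exists>\<gamma>. poly_family \<gamma> \<and> (\<forall>b\<in>A.
      ((\<lambda>s. fst (\<gamma> s b)) has_field_derivative (if j = (b, True) then 1 else 0)) (at 0) \<and>
      ((\<lambda>s. snd (\<gamma> s b)) has_field_derivative (if j = (b, False) then 1 else 0)) (at 0))"
  proof
    fix j assume "j \<in> I"
    then obtain a c where j: "j = (a, c)" "a \<in> A" by (auto simp: I_def)
    obtain \<gamma> where \<gamma>: "poly_family \<gamma>"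
      "\<And>b. b \<in> A \<Longrightarrow> ((\<lambda>s. fst (\<gamma> s b)) has_field_derivative (if b = a then (if c then 1 else 0) else 0)) (at 0)"
      "\<And>b. b \<in> A \<Longrightarrow> ((\<lambda>s. snd (\<gamma> s b)) has_field_derivative (if b = a then (if c then 0 else 1) else 0)) (at 0)"
      using poly_family_prescribed_velocity[OF A j(2), of "if c then 1 else 0" "if c then 0 else 1"] by blast
    have "(if b = a then (if c then 1 else 0) else 0) = (if j = (b, True) then 1 else (0::complex))"
      "(if b = a then (if c then 0 else 1) else 0) = (if j = (b, False) then 1 else (0::complex))" for b
      by (auto simp: j)
    from \<gamma>[unfolded this] show "\<exists>\<gamma>. poly_family \<gamma> \<and> (\<forall>b\<in>A.
      ((\<lambda>s. fst (\<gamma> s b)) has_field_derivative (if j = (b, True) then 1 else 0)) (at 0) \<and>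
      ((\<lambda>s. snd (\<gamma> s b)) has_field_derivative (if j = (b, False) then 1 else 0)) (at 0))" by blast
  qed
  then obtain \<gamma> where \<gamma>: "\<And>j. j \<in> I \<Longrightarrow> poly_family (\<gamma> j)"
    "\<And>j b. j \<in> I \<Longrightarrow> b \<in> A \<Longrightarrow>
      ((\<lambda>s. fst (\<gamma> j s b)) has_field_derivative (if j = (b, True) then 1 else 0)) (at 0)"
    "\<And>j b. j \<in> I \<Longrightarrow> b \<in> A \<Longrightarrow>
      ((\<lambda>s. snd (\<gamma> j s b)) has_field_derivative (if j = (b, False) then 1 else 0)) (at 0)"
    unfolding bchoice_iff by blast
  obtain \<Phi> where \<Phi>: "\<And>t. \<Phi> t \<in> shear_slide_words" "\<And>t. (\<forall>i\<in>I. t i = 0) \<Longrightarrow> \<Phi> t = id"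
    "\<And>t j. j \<in> I \<Longrightarrow> (\<forall>i\<in>I - {j}. t i = 0) \<Longrightarrow> \<Phi> t = \<gamma> j (t j)"
    "\<And>z. poly_fun {\<lambda>t. t i |i. i \<in> I} (\<lambda>t. fst (\<Phi> t z))"
    "\<And>z. poly_fun {\<lambda>t. t i |i. i \<in> I} (\<lambda>t. snd (\<Phi> t z))"
    using poly_family_product[where I = I and \<gamma> = \<gamma>, OF I \<gamma>(1)] by blast
  \<comment> \<open>Displacements rather than positions, so that \<open>F\<close> vanishes at 0 and
    has the identity matrix as its derivative there.\<close>
  define F where "F k t = (if snd k then fst (\<Phi> t (fst k)) - fst (fst k) else snd (\<Phi> t (fst k)) - snd (fst k))"
    for k t
  have F_poly: "poly_fun {\<lambda>t. t i |i. i \<in> I} (F k)" for k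
    unfolding F_def by (cases "snd k") (simp_all only: if_True if_False poly_fun_diff poly_fun.const \<Phi>(4,5))
  have F_0: "F k (\<lambda>_. 0) = 0" for k
    unfolding F_def by (simp add: \<Phi>(2))
  have F_deriv: "((\<lambda>s. F k (\<lambda>i. if i = j then s else 0)) has_field_derivative (if j = k then 1 else 0)) (at 0)"
    if "j \<in> I" "k \<in> I" for j k
  proof -
    have "\<Phi> (\<lambda>i. if i = j then s else 0) = \<gamma> j s" for s using \<Phi>(3)[OF that(1)] by simp
    moreover have "fst k \<in> A" using that by (auto simp: I_def)
    ultimately show ?thesis
      using \<gamma>(2,3)[OF that(1), of "fst k"] unfolding F_def
      by (cases k; cases "snd k") (auto intro!: derivative_eq_intros split: if_splits)
  qed
  obtain \<epsilon> :: real where \<epsilon>: "0 < \<epsilon>"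
    "\<And>y. (\<And>k. k \<in> I \<Longrightarrow> norm (y k) < \<epsilon>) \<Longrightarrow> \<exists>t. \<forall>k\<in>I. F k t = y k"
    using poly_map_locally_onto[OF I F_poly F_0 F_deriv] by blast
  show ?thesis
  proof (rule that[OF \<epsilon>(1)])
    fix \<psi> :: "complex \<times> complex \<Rightarrow> complex \<times> complex"
    assume \<psi>: "\<And>a. a \<in> A \<Longrightarrow> norm (fst (\<psi> a) - fst a) < \<epsilon> \<and> norm (snd (\<psi> a) - snd a) < \<epsilon>"
    define y where "y k = (if snd k then fst (\<psi> (fst k)) - fst (fst k) else snd (\<psi> (fst k)) - snd (fst k))" for k
    have "norm (y k) < \<epsilon>" if "k \<in> I" for k
      using that \<psi> by (auto simp: y_def I_def)
    then obtain t where t: "\<And>k. k \<in> I \<Longrightarrow> F k t = y k" using \<epsilon>(2) by blast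
    have "\<Phi> t a = \<psi> a" if "a \<in> A" for a
      using t[of "(a, True)"] t[of "(a, False)"] that by (auto simp: I_def F_def y_def prod_eq_iff)
    with \<Phi>(1)[of t] show "\<exists>g\<in>shear_slide_words. \<forall>a\<in>A. g a = \<psi> a" by blast
  qed
qed

lemma words_transitive:
  fixes x y :: "nat \<Rightarrow> complex \<times> complex"
  assumes x: "inj_on x {..<m}" and y: "inj_on y {..<m}"
  shows "\<exists>g\<in>shear_slide_words. \<forall>i<m. g (x i) = y i"
proof -
  define dx dy where "dx i = fst (y i) - fst (x i)" and "dy i = snd (y i) - snd (x i)" for i
  define L where "L s i = (fst (x i) + s * dx i, snd (x i) + s * dy i)" for s i
  have L01: "L 0 = x" "L 1 = y" by (auto simp: L_def dx_def dy_def)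
  define S where "S = {s. inj_on (L s) {..<m}}"
  define R where "R s s' \<longleftrightarrow> (\<exists>g\<in>shear_slide_words. \<forall>i<m. g (L s i) = L s' i)" for s s'
  \<comment> \<open>A collision of two entries forces an equation a + s b = 0 in a coordinate where
    the corresponding entries of \<open>x\<close> differ; there a is nonzero, so at most one
    \<open>s\<close> solves it.\<close>
  have root: "finite {s. a + s * b = 0}" if "a \<noteq> 0" for a b :: complex
  proof (rule finite_subset)
    show "{s. a + s * b = 0} \<subseteq> {- a / b}"
    proof
      fix s assume "s \<in> {s. a + s * b = 0}"
      then have "s * b = - a" by (simp add: eq_neg_iff_add_eq_0 add.commute)
      moreover from this have "b \<noteq> 0" using that by auto
      ultimately show "s \<in> {- a / b}" by (simp add: nonzero_eq_divide_eq del: divide_minus_left)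
    qed
  qed simp
  have "finite {s. L s i = L s j}" if "i < m" "j < m" "i \<noteq> j" for i j
  proof -
    have "x i \<noteq> x j" using x that by (auto dest: inj_onD)
    then consider "fst (x i) - fst (x j) \<noteq> 0" | "snd (x i) - snd (x j) \<noteq> 0"
      by (auto simp: prod_eq_iff)
    then show ?thesis
    proof cases
      case 1
      show ?thesis
        by (rule finite_subset[OF _ root[OF 1, of "dx i - dx j"]]) (auto simp: L_def algebra_simps)
    next
      case 2
      show ?thesis
        by (rule finite_subset[OF _ root[OF 2, of "dy i - dy j"]]) (auto simp: L_def algebra_simps)
    qed
  qed
  then have "finite (\<Union>i\<in>{..<m}. \<Union>j\<in>{..<m} - {i}. {s. L s i = L s j})" by auto
  moreover have "- S \<subseteq> (\<Union>i\<in>{..<m}. \<Union>j\<in>{..<m} - {i}. {s. L s i = L s j})"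
    by (auto simp: S_def inj_on_def)
  ultimately have "finite (- S)" by (rule finite_subset[rotated])
  then have "connected (UNIV - (- S))" by (intro connected_open_delete_finite) auto
  then have "connected S" by (simp add: Diff_Compl)
  moreover have "0 \<in> S" "1 \<in> S" using x y by (auto simp: S_def L01)
  moreover have "R s' s" if "R s s'" for s s'
  proof -
    from that obtain g where g: "g \<in> shear_slide_words" "\<forall>i<m. g (L s i) = L s' i" by (auto simp: R_def)
    obtain h where h: "h \<in> shear_slide_words" "h \<circ> g = id" using words_left_inverse[OF g(1)] by blast
    have "h (L s' i) = L s i" if "i < m" for i
      using fun_cong[OF h(2), of "L s i"] g(2) that by simp
    with h(1) show ?thesis by (auto simp: R_def)
  qed
  moreover have "R s s''" if "R s s'" "R s' s''" for s s' s''
  proof -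
    from that obtain g h where "g \<in> shear_slide_words" "\<forall>i<m. g (L s i) = L s' i"
      "h \<in> shear_slide_words" "\<forall>i<m. h (L s' i) = L s'' i" by (auto simp: R_def)
    then show ?thesis unfolding R_def by (intro bexI[of _ "h \<circ> g"] words_comp) auto
  qed
  moreover have "\<exists>T. openin (top_of_set S) T \<and> s \<in> T \<and> (\<forall>s'\<in>T. R s s')" if s: "s \<in> S" for s
  proof -
    obtain \<epsilon> :: real where \<epsilon>: "0 < \<epsilon>"
      "\<And>\<psi>. (\<And>a. a \<in> L s ` {..<m} \<Longrightarrow> norm (fst (\<psi> a) - fst a) < \<epsilon> \<and> norm (snd (\<psi> a) - snd a) < \<epsilon>) \<Longrightarrow>
        \<exists>g\<in>shear_slide_words. \<forall>a\<in>L s ` {..<m}. g a = \<psi> a"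
      using words_locally_transitive[of "L s ` {..<m}"] by blast
    \<comment> \<open>\<open>M\<close> bounds the speed of every coordinate along the line, so
      changing \<open>s\<close> by less than \<open>\<epsilon> / M\<close> moves each coordinate by
      less than \<open>\<epsilon>\<close>.\<close>
    define M where "M = 1 + (\<Sum>i<m. norm (dx i) + norm (dy i))"
    have M0: "0 < M" unfolding M_def by (intro add_pos_nonneg sum_nonneg) auto
    have M: "norm (dx i) + norm (dy i) \<le> M" if "i < m" for i
      unfolding M_def using that by (intro add_increasing member_le_sum) auto
    have "R s s'" if s': "dist s s' < \<epsilon> / M" for s'
    proof -
      \<comment> \<open>Entries of the tuple at \<open>s\<close> go to those at \<open>s'\<close>.
        As \<open>s \<in> S\<close>, the entries at \<open>s\<close> are distinct and each
        determines its index.\<close>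
      define \<psi> where "\<psi> a = L s' (inv_into {..<m} (L s) a)" for a
      have \<psi>: "\<psi> (L s i) = L s' i" if "i < m" for i
        using s that by (simp add: \<psi>_def S_def inv_into_f_f)
      have small: "norm ((s' - s) * d) < \<epsilon>" if "norm d \<le> M" for d
      proof -
        have "norm ((s' - s) * d) \<le> dist s s' * M"
          using that by (simp add: norm_mult dist_norm norm_minus_commute mult_left_mono)
        also have "\<dots> < \<epsilon>" using s' M0 by (simp add: field_simps)
        finally show ?thesis .
      qed
      have "norm (fst (\<psi> a) - fst a) < \<epsilon> \<and> norm (snd (\<psi> a) - snd a) < \<epsilon>" if "a \<in> L s ` {..<m}" for a
      proof -
        from that obtain i where i: "i < m" "a = L s i" by auto
        have "norm (dx i) \<le> M" "norm (dy i) \<le> M"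
          using M[OF i(1)] norm_ge_zero[of "dx i"] norm_ge_zero[of "dy i"] by linarith+
        from this[THEN small] show ?thesis
          by (simp add: i \<psi>) (simp add: L_def algebra_simps)
      qed
      from \<epsilon>(2)[OF this] show ?thesis using \<psi> by (auto simp: R_def)
    qed
    then show ?thesis
      using s M0 \<epsilon>(1) by (intro exI[of _ "S \<inter> ball s (\<epsilon> / M)"]) (auto simp: openin_open_Int)
  qed
  ultimately have "R 0 1" by (intro connected_equivalence_relation[of S 0 1 R])
  then show ?thesis by (simp add: R_def L01)
qed

section \<open>From words to the generated subgroup\<close>

text \<open>Negating the parameter inverts \<open>\<phi> t\<close>, which makes it an
  automorphism.\<close>

lemma one_parameter_subgroupI:
  fixes p q :: "complex poly poly poly"
  assumes \<phi>: "\<And>t z. \<phi> t z = (eval2 (poly p [:[:t:]:]) z, eval2 (poly q [:[:t:]:]) z)"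
    and add: "\<And>s t. \<phi> s \<circ> \<phi> t = \<phi> (s + t)" and "\<phi> 0 = id" and "inj \<phi>"
  shows "one_parameter_subgroup (range \<phi>)" "range \<phi> \<subseteq> carrier Aut_C2"
proof -
  have poly: "polynomial_map (\<phi> t)" for t unfolding polynomial_map_def using \<phi> by blast
  have aut: "\<phi> t \<in> carrier Aut_C2" for t
    using poly[of t] poly[of "- t"] add[of t "- t"] add[of "- t" t] \<open>\<phi> 0 = id\<close> by (auto simp: Aut_C2_def)
  then have "\<phi> \<in> hom additive_group_C Aut_C2"
    by (auto simp: hom_def additive_group_C_def add) (auto simp: Aut_C2_def add)
  then show "one_parameter_subgroup (range \<phi>)"
    unfolding one_parameter_subgroup_def using \<phi> \<open>inj \<phi>\<close> by blast
  show "range \<phi> \<subseteq> carrier Aut_C2" using aut by blast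
qed

lemma shear_one_parameter_subgroup:
  "one_parameter_subgroup (range shear)" "range shear \<subseteq> carrier Aut_C2"
proof -
  have "inj shear"
    \<comment> \<open>Every shear fixes the line y = 0 pointwise; the point (0, 1) is displaced by
      the parameter.\<close>
    by (rule injI) (auto simp: shear_def dest: fun_cong[of _ _ "(0, 1)"])
  \<comment> \<open>The outermost indeterminate is t, then y, then x: the lists spell x + t y^2 and
    y.\<close>
  note * = one_parameter_subgroupI[of shear "[:[:[:0, 1:]:], [:0, 0, 1:]:]" "[:[:0, 1:]:]", OF _ shear_add shear_0 this]
  show "one_parameter_subgroup (range shear)" "range shear \<subseteq> carrier Aut_C2"
    by (rule *; auto simp: shear_def eval2_def algebra_simps power2_eq_square)+
qed

lemma slide_one_parameter_subgroup:
  "one_parameter_subgroup (range slide)" "range slide \<subseteq> carrier Aut_C2"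
proof -
  have "inj slide"
    by (rule injI) (auto simp: slide_def dest: fun_cong[of _ _ "(0, 0)"])
  \<comment> \<open>The lists spell x + t and y - t x - t^2 / 2.\<close>
  note * = one_parameter_subgroupI[of slide "[:[:[:0, 1:]:], 1:]" "[:[:0, 1:], [:[:0, - 1:]:], [:[:- 1 / 2:]:]:]",
      OF _ slide_add slide_0 this]
  show "one_parameter_subgroup (range slide)" "range slide \<subseteq> carrier Aut_C2"
    by (rule *; auto simp: slide_def eval2_def algebra_simps power2_eq_square)+
qed

text \<open>Through this inclusion transitivity passes from the words to the generated group.
  \<open>subgroup_generated\<close> intersects its generators with the carrier, so the inclusions of
  both ranges in \<open>Aut_C2\<close> enter here.\<close>

lemma words_generated:
  "g \<in> shear_slide_words \<Longrightarrow> g \<in> carrier (subgroup_generated Aut_C2 (range shear \<union> range slide))"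
proof (induction rule: shear_slide_words.induct)
  have one: "id = \<one>\<^bsub>Aut_C2\<^esub>" and mult: "f \<circ> g = f \<otimes>\<^bsub>Aut_C2\<^esub> g" for f g
    by (simp_all add: Aut_C2_def)
  {
    case id
    show ?case unfolding one carrier_subgroup_generated by (rule generate.one)
  }
  case (shear g \<alpha>)
  then show ?case
    unfolding mult carrier_subgroup_generated using shear_one_parameter_subgroup(2)
    by (intro generate.eng[OF generate.incl]) auto
  case (slide g \<beta>)
  then show ?case
    unfolding mult carrier_subgroup_generated using slide_one_parameter_subgroup(2)
    by (intro generate.eng[OF generate.incl]) auto
qed

lemma group_action_subgroup_generated_Aut_C2:
  "group_action (subgroup_generated Aut_C2 H) UNIV (\<lambda>g z. g z)"
proof -
  have "g \<in> Bij UNIV" if g: "g \<in> carrier Aut_C2" for g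
  proof -
    obtain h where "g \<circ> h = id" "h \<circ> g = id" using g by (auto simp: Aut_C2_def)
    then have "bij g" using o_bij by blast
    \<comment> \<open>\<open>Bij\<close> also asks for extensionality, which is vacuous on
      \<open>UNIV\<close>.\<close>
    then show ?thesis by (simp add: Bij_def extensional_def)
  qed
  moreover have "carrier (subgroup_generated Aut_C2 H) \<subseteq> carrier Aut_C2"
    by (rule group.carrier_subgroup_generated_subset[OF group_Aut_C2])
  ultimately have "(\<lambda>g z. g z) \<in> hom (subgroup_generated Aut_C2 H) (BijGroup UNIV)"
    by (auto simp: hom_def BijGroup_def compose_def fun_eq_iff) (auto simp: Aut_C2_def subgroup_generated_def)
  then show ?thesis
    unfolding group_action_def group_hom_def group_hom_axioms_def
    using group.group_subgroup_generated[OF group_Aut_C2] group_BijGroup by blast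
qed

theorem corollary29:
  fixes U V :: "(complex \<times> complex \<Rightarrow> complex \<times> complex) set"
    and G :: "(complex \<times> complex \<Rightarrow> complex \<times> complex) monoid"
  defines "U \<equiv> {\<lambda>(x, y). (x + \<alpha> * y^2, y) | \<alpha>. \<alpha> \<in> UNIV}"
    and "V \<equiv> {\<lambda>(x, y). (x + \<beta>, y - \<beta> * x - \<beta>^2 / 2) | \<beta>. \<beta> \<in> UNIV}"
    and "G \<equiv> subgroup_generated Aut_C2 (U \<union> V)"
  shows "one_parameter_subgroup U \<and> one_parameter_subgroup V \<and>
    infinitely_transitive G UNIV (\<lambda>g z. g z)"
proof -
  have UV: "U = range shear" "V = range slide"
    by (auto simp: U_def V_def shear_def slide_def)
  have "\<exists>g\<in>carrier G. map (\<lambda>z. g z) xs = ys"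
    if xs: "length xs = m" "distinct xs" and ys: "length ys = m" "distinct ys" for xs ys m
  proof -
    obtain g where "g \<in> shear_slide_words" "\<forall>i<m. g (xs ! i) = ys ! i"
      using words_transitive[of "(!) xs" m "(!) ys"] xs ys by (auto simp: inj_on_def nth_eq_iff_index_eq)
    then show ?thesis
      using words_generated xs ys by (intro bexI[of _ g]) (auto simp: G_def UV intro: nth_equalityI)
  qed
  then show ?thesis
    using shear_one_parameter_subgroup(1) slide_one_parameter_subgroup(1) group_action_subgroup_generated_Aut_C2
    by (auto simp: infinitely_transitive_def UV G_def)
qed

end
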